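(* Consider the bimodal Filippov system $\dot x=f(x)$ on an open set $U\subseteq\mathbb{R}^n$, with $f(x)=f^+(x)$ if $H(x)>0$ and $f(x)=f^-(x)$ if $H(x)<0$, and let $f_\varepsilon$, $\varepsilon>0$, be its $\varphi$-regularization, where $\varphi$ is a transition function. Let $|\cdot|$ be a norm on $\mathbb{R}^n$ and let $\mathcal{C}\subseteq U$ be a forward-invariant $K$-reachable set. Suppose that there exists a positive constant $\bar\varepsilon<1$ such that for all $0<\varepsilon<\bar\varepsilon$ the regularized system $\dot x=f_\varepsilon(x)$ is incrementally exponentially stable in $\mathcal{C}$ with convergence rate $c>0$ (and constant $K$), i.e. any two of its solutions $x_\varepsilon(t),y_\varepsilon(t)$ starting in $\mathcal{C}$ at time $t_0$ satisfy $|x_\varepsilon(t)-y_\varepsilon(t)|\le K e^{-c(t-t_0)}|x_\varepsilon(t_0)-y_\varepsilon(t_0)|$ for all $t\ge t_0$. Then (in the limit $\varepsilon\to0^+$) any two solutions $x(t)$ and $y(t)$ of the bimodal Filippov system with initial conditions $x(t_0)=x_0\in\mathcal{C}$, $y(t_0)=y_0\in\mathcal{C}$ converge towards each other in $\mathcal{C}$, namely $$|x(t)-y(t)|\le K\,e^{-c(t-t_0)}\,|x_0-y_0|,\qquad \forall t\ge t_0 .$$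
   Context: Bimodal Filippov system: $U\subseteq\mathbb{R}^n$ is open, $f^+,f^-\in C^1(U,\mathbb{R}^n)$, $H:U\to\mathbb{R}$ is smooth with $0$ a regular value, i.e. $\nabla H(x)=[\partial H/\partial x_1\ \dots\ \partial H/\partial x_n]\ne0$ (a row vector) for all $x$ in the switching manifold $\Sigma=\{x\in U:H(x)=0\}$; $\mathcal{S}^+=\{x\in U:H(x)>0\}$, $\mathcal{S}^-=\{x\in U:H(x)<0\}$. The system is $\dot x=f^+(x)$ on $\mathcal{S}^+$ and $\dot x=f^-(x)$ on $\mathcal{S}^-$. Standing assumption: solutions are understood in the sense of Filippov (in the sliding region $\{x\in\Sigma:\nabla H f^+<0<\nabla H f^-\}$ the motion follows the convex combination $f^s=(1-\lambda)f^++\lambda f^-$, $\lambda\in[0,1]$, with $\nabla H f^s=0$), and right uniqueness of solutions holds in $U$ (so the escaping region $\{x\in\Sigma:\nabla H f^->0\text{ fails}, \nabla H f^+>0,\ \nabla H f^-<0\}$, i.e. the set of $x\in\Sigma$ with $\nabla H f^+>0$ and $\nabla H f^-<0$, is excluded). Transition function: a function $\varphi:\mathbb{R}\to\mathbb{R}$ that is continuous, continuously differentiable on each of $(-\infty,-1)$, $(-1,1)$, $(1,\infty)$ with derivative on each piece extending continuously to the boundary, and such that $\varphi(s)=1$ for $s\ge1$, $\varphi(s)=-1$ for $s\le-1$, $\varphi(s)\in(-1,1)$ and $\varphi'(s)>0$ for $s\in(-1,1)$. $\varphi$-regularization: for $\varepsilon>0$, $f_\varepsilon(x)=\frac12\left[1+\varphi\left(\frac{H(x)}{\varepsilon}\right)\right]f^+(x)+\frac12\left[1-\varphi\left(\frac{H(x)}{\varepsilon}\right)\right]f^-(x)$.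 $K$-reachable: $\mathcal{C}\subseteq\mathbb{R}^n$ is $K$-reachable ($K>0$) if for any $x_0,y_0\in\mathcal{C}$ there is a continuously differentiable curve $\gamma:[0,1]\to\mathcal{C}$ with $\gamma(0)=x_0$, $\gamma(1)=y_0$, $|\gamma'(r)|\le K|y_0-x_0|$ for all $r$. Forward invariant: $\mathcal{C}$ is forward invariant for a system if solutions starting in $\mathcal{C}$ at time $t_0$ stay in $\mathcal{C}$ for all $t\ge t_0$. Incremental exponential stability of a system in $\mathcal{C}$ presupposes that $\mathcal{C}$ is forward invariant for that system; here $\mathcal{C}$ is forward invariant for the Filippov system and for the regularized systems with $0<\varepsilon<\bar\varepsilon$. *)

theory Defs
  imports "HOL-Analysis.Analysis"
begin

definition partial_deriv :: "'n \<Rightarrow> (real^'n \<Rightarrow> 'b::real_normed_vector) \<Rightarrow> real^'n \<Rightarrow> 'b" where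
  "partial_deriv i h x = frechet_derivative h (at x) (axis i 1)"

definition grad :: "(real^'n \<Rightarrow> real) \<Rightarrow> real^'n \<Rightarrow> real^'n" where
  "grad h x = (\<chi> i. partial_deriv i h x)"

text \<open>Intended for open \<open>U\<close>.\<close>

primrec C_k_on :: "nat \<Rightarrow> (real^'n \<Rightarrow> 'b::real_normed_vector) \<Rightarrow> (real^'n) set \<Rightarrow> bool" where
  "C_k_on 0 h U \<longleftrightarrow> continuous_on U h"
| "C_k_on (Suc k) h U \<longleftrightarrow>
     (\<forall>x\<in>U. h differentiable (at x)) \<and> (\<forall>i. C_k_on k (partial_deriv i h) U)"

definition smooth_on :: "(real^'n \<Rightarrow> 'b::real_normed_vector) \<Rightarrow> (real^'n) set \<Rightarrow> bool" where
  "smooth_on h U \<longleftrightarrow> (\<forall>k. C_k_on k h U)"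

definition is_norm :: "('a::real_vector \<Rightarrow> real) \<Rightarrow> bool" where
  "is_norm N \<longleftrightarrow>
     (\<forall>x. N x \<ge> 0) \<and> (\<forall>x. N x = 0 \<longleftrightarrow> x = 0) \<and>
     (\<forall>a x. N (a *\<^sub>R x) = \<bar>a\<bar> * N x) \<and> (\<forall>x y. N (x + y) \<le> N x + N y)"

definition bimodal_system ::
  "(real^'n) set \<Rightarrow> (real^'n \<Rightarrow> real^'n) \<Rightarrow> (real^'n \<Rightarrow> real^'n) \<Rightarrow> (real^'n \<Rightarrow> real) \<Rightarrow> bool" where
  "bimodal_system U f_plus f_minus H \<longleftrightarrow>
     open U \<and> C_k_on 1 f_plus U \<and> C_k_on 1 f_minus U \<and>
     smooth_on H U \<and> (\<forall>x\<in>U. H x = 0 \<longrightarrow> grad H x \<noteq> 0)"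

text \<open>Solutions are defined on intervals with left endpoint \<open>t\<^sub>0\<close>, bounded or not: \<open>{t\<^sub>0..}\<close>,
  \<open>{t\<^sub>0..T}\<close> or \<open>{t\<^sub>0..<T}\<close>. The estimates below hold at every time of the common interval of
  definition, so for solutions on \<open>{t\<^sub>0..}\<close> at all \<open>t \<ge> t\<^sub>0\<close>.\<close>

definition forward_interval :: "real \<Rightarrow> real set \<Rightarrow> bool" where
  "forward_interval t0 J \<longleftrightarrow> is_interval J \<and> t0 \<in> J \<and> (\<forall>t\<in>J. t0 \<le> t)"

text \<open>A division of its own union is a finite family of non-overlapping compact intervals.\<close>

definition absolutely_continuous_on :: "real set \<Rightarrow> (real \<Rightarrow> 'a::real_normed_vector) \<Rightarrow> bool" where
  "absolutely_continuous_on S x \<longleftrightarrow>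
     (\<forall>e>0. \<exists>d>0. \<forall>D. D division_of \<Union>D \<and> \<Union>D \<subseteq> S \<and> (\<Sum>k\<in>D. Sup k - Inf k) < d
        \<longrightarrow> (\<Sum>k\<in>D. norm (x (Sup k) - x (Inf k))) < e)"

definition filippov_field ::
  "(real^'n \<Rightarrow> real^'n) \<Rightarrow> (real^'n \<Rightarrow> real^'n) \<Rightarrow> (real^'n \<Rightarrow> real) \<Rightarrow> real^'n \<Rightarrow> (real^'n) set" where
  "filippov_field f_plus f_minus H x =
     (if H x > 0 then {f_plus x}
      else if H x < 0 then {f_minus x}
      else {(1 - l) *\<^sub>R f_plus x + l *\<^sub>R f_minus x | l. 0 \<le> l \<and> l \<le> 1})"

text \<open>No tangency condition is needed on the switching manifold: at almost every time spent there
  by a solution its velocity is tangent to the manifold, which singles out the sliding vector field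
  in the sliding region.\<close>

definition filippov_solution ::
  "(real^'n) set \<Rightarrow> (real^'n \<Rightarrow> real^'n) \<Rightarrow> (real^'n \<Rightarrow> real^'n) \<Rightarrow> (real^'n \<Rightarrow> real) \<Rightarrow>
   real \<Rightarrow> real set \<Rightarrow> (real \<Rightarrow> real^'n) \<Rightarrow> bool" where
  "filippov_solution U f_plus f_minus H t0 J x \<longleftrightarrow>
     forward_interval t0 J \<and> (\<forall>t\<in>J. x t \<in> U) \<and>
     (\<forall>a b. {a..b} \<subseteq> J \<longrightarrow> absolutely_continuous_on {a..b} x) \<and>
     (AE t in lebesgue. t \<in> J \<longrightarrow>
        (\<exists>v\<in>filippov_field f_plus f_minus H (x t). (x has_vector_derivative v) (at t within J)))"

definition classical_solution ::
  "(real^'n) set \<Rightarrow> (real^'n \<Rightarrow> real^'n) \<Rightarrow> real \<Rightarrow> real set \<Rightarrow> (real \<Rightarrow> real^'n) \<Rightarrow> bool" where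
  "classical_solution U f t0 J x \<longleftrightarrow>
     forward_interval t0 J \<and> (\<forall>t\<in>J. x t \<in> U) \<and>
     (\<forall>t\<in>J. (x has_vector_derivative f (x t)) (at t within J))"

definition right_unique_solutions :: "(real \<Rightarrow> real set \<Rightarrow> (real \<Rightarrow> real^'n) \<Rightarrow> bool) \<Rightarrow> bool" where
  "right_unique_solutions sol \<longleftrightarrow>
     (\<forall>t0 J x y. sol t0 J x \<and> sol t0 J y \<and> x t0 = y t0 \<longrightarrow> (\<forall>t\<in>J. x t = y t))"

definition forward_invariant ::
  "(real \<Rightarrow> real set \<Rightarrow> (real \<Rightarrow> real^'n) \<Rightarrow> bool) \<Rightarrow> (real^'n) set \<Rightarrow> bool" where
  "forward_invariant sol C \<longleftrightarrow>
     (\<forall>t0 J x. sol t0 J x \<and> x t0 \<in> C \<longrightarrow> (\<forall>t\<in>J. x t \<in> C))"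

definition incrementally_exponentially_stable ::
  "(real^'n \<Rightarrow> real) \<Rightarrow> (real \<Rightarrow> real set \<Rightarrow> (real \<Rightarrow> real^'n) \<Rightarrow> bool) \<Rightarrow>
   (real^'n) set \<Rightarrow> real \<Rightarrow> real \<Rightarrow> bool" where
  "incrementally_exponentially_stable N sol C K c \<longleftrightarrow>
     forward_invariant sol C \<and>
     (\<forall>t0 J x y. sol t0 J x \<and> sol t0 J y \<and> x t0 \<in> C \<and> y t0 \<in> C \<longrightarrow>
        (\<forall>t\<in>J. N (x t - y t) \<le> K * exp (- c * (t - t0)) * N (x t0 - y t0)))"

definition transition_function :: "(real \<Rightarrow> real) \<Rightarrow> bool" where
  "transition_function \<phi> \<longleftrightarrow>
     continuous_on UNIV \<phi> \<and>
     (\<forall>S\<in>{{..<-1}, {-1<..<1}, {1<..}}. \<exists>D. continuous_on (closure S) D \<and>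
        (\<forall>s\<in>S. (\<phi> has_real_derivative D s) (at s))) \<and>
     (\<forall>s\<ge>1. \<phi> s = 1) \<and> (\<forall>s\<le>-1. \<phi> s = -1) \<and>
     (\<forall>s\<in>{-1<..<1}. \<phi> s \<in> {-1<..<1} \<and> deriv \<phi> s > 0)"

definition regularization ::
  "(real \<Rightarrow> real) \<Rightarrow> (real^'n \<Rightarrow> real^'n) \<Rightarrow> (real^'n \<Rightarrow> real^'n) \<Rightarrow> (real^'n \<Rightarrow> real) \<Rightarrow>
   real \<Rightarrow> real^'n \<Rightarrow> real^'n" where
  "regularization \<phi> f_plus f_minus H \<epsilon> x =
     (1/2 * (1 + \<phi> (H x / \<epsilon>))) *\<^sub>R f_plus x + (1/2 * (1 - \<phi> (H x / \<epsilon>))) *\<^sub>R f_minus x"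

definition K_reachable :: "(real^'n \<Rightarrow> real) \<Rightarrow> real \<Rightarrow> (real^'n) set \<Rightarrow> bool" where
  "K_reachable N K C \<longleftrightarrow>
     (\<forall>x0\<in>C. \<forall>y0\<in>C. \<exists>\<gamma> \<gamma>'. \<gamma> 0 = x0 \<and> \<gamma> 1 = y0 \<and> continuous_on {0..1} \<gamma>' \<and>
        (\<forall>r\<in>{0..1::real}. \<gamma> r \<in> C \<and> (\<gamma> has_vector_derivative \<gamma>' r) (at r within {0..1}) \<and>
           N (\<gamma>' r) \<le> K * N (y0 - x0)))"

end

theory Submission
  imports Defs "HOL-Complex_Analysis.Great_Picard"
begin

text \<open>On compact time intervals, solutions of the regularized systems converge uniformly to the Filippov
  solution with the same initial value, so the contraction estimate passes to the limit
  \<open>\<epsilon> \<rightarrow> 0\<close>. For the convergence, replace the data by bounded continuous extensions from a compact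
  tube around the Filippov solution. The regularized solutions (Peano) are then equi-Lipschitz and
  have a uniformly convergent subsequence. Its limit solves the Filippov inclusion while it is in
  the tube; by right uniqueness it is the given solution and never leaves the tube.

  The inclusion needs no weak compactness in \<open>L\<^sup>1\<close>: a regularized solution has velocity
  \<open>(1 - w) f\<^sup>+ + w f\<^sup>-\<close> with \<open>0 \<le> w \<le> 1\<close>, and the scalar functions \<open>\<integral> w\<close> converge uniformly along a
  subsequence. Wherever their limit is differentiable, so is the limit solution, and the derivative
  of the former supplies the convex coefficient.\<close>

subsection \<open>Differentiability of monotone Lipschitz functions\<close>

text \<open>The two hypotheses together make \<open>F\<close> 1-Lipschitz. Right continuity is the
  form in which \<open>interval_measure\<close> asks for it.\<close>

lemma mono_lipschitz_continuous_at_right: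
  fixes F :: "real \<Rightarrow> real"
  assumes mono: "\<And>s t. s \<le> t \<Longrightarrow> F s \<le> F t" and lip: "\<And>s t. s \<le> t \<Longrightarrow> F t - F s \<le> t - s"
  shows "continuous (at_right a) F"
proof -
  have "dist (F s) (F t) \<le> dist s t" for s t
    using lip[of s t] lip[of t s] mono[of s t] mono[of t s] by (auto simp: dist_real_def abs_if)
  then have "continuous_on UNIV F"
    unfolding continuous_on_iff by (meson order_le_less_trans)
  then show ?thesis
    by (simp add: continuous_at_imp_continuous_within continuous_on_eq_continuous_at)
qed

text \<open>Besides \<open>F\<close>, also \<open>t - F t\<close> is nondecreasing, and the
  Stieltjes measures of the two functions add up to Lebesgue measure. Hence Lebesgue null sets are
  null for both.\<close>

lemma mono_lipschitz_absolutely_continuous: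
  fixes F :: "real \<Rightarrow> real"
  assumes mono: "\<And>s t. s \<le> t \<Longrightarrow> F s \<le> F t" and lip: "\<And>s t. s \<le> t \<Longrightarrow> F t - F s \<le> t - s"
  shows "absolutely_continuous lborel (interval_measure F)"
proof -
  define G where "G = (\<lambda>t. t - F t)"
  have G_mono: "G s \<le> G t" if "s \<le> t" for s t
    using lip[OF that] by (simp add: G_def)
  have F_cont: "continuous (at_right a) F" for a
    using mono_lipschitz_continuous_at_right[OF mono lip] .
  then have G_cont: "continuous (at_right a) G" for a
    unfolding G_def by (intro continuous_intros)
  let ?F = "interval_measure F" and ?G = "interval_measure G"
  \<comment> \<open>Once this sum of the two measures gives every open interval its length,
    \<open>lborel_eqI\<close> identifies it with Lebesgue measure.\<close>
  define M where "M = measure_of UNIV (sets borel) (\<lambda>A. emeasure ?F A + emeasure ?G A)"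
  have sets_M: "sets M = sets borel"
    using sets.sigma_sets_eq[of "borel :: real measure"] by (simp add: M_def)
  have "countably_additive (sets borel) (\<lambda>A. emeasure ?F A + emeasure ?G A)"
    by (rule countably_additiveI) (simp add: suminf_add[symmetric] suminf_emeasure)
  then have M: "emeasure M A = emeasure ?F A + emeasure ?G A" if "A \<in> sets borel" for A
    using that sets.sigma_algebra_axioms[of borel] unfolding M_def
    by (intro emeasure_measure_of_sigma) (auto simp: positive_def)
  have "lborel = M"
  proof (rule lborel_eqI)
    fix l u :: real assume "\<And>b. b \<in> Basis \<Longrightarrow> l \<bullet> b \<le> u \<bullet> b"
    then have "l \<le> u" by simp
    have *: "emeasure M {p<..q} = ennreal (q - p)" if "p \<le> q" for p q
      using that mono lip[of p q]
      by (simp add: M emeasure_interval_measure_Ioc[OF that mono F_cont]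
          emeasure_interval_measure_Ioc[OF that G_mono G_cont])
         (simp add: G_def flip: ennreal_plus)
    show "emeasure M (box l u) = (\<Prod>b\<in>Basis. (u - l) \<bullet> b)"
    proof (cases "l = u")
      case False
      with \<open>l \<le> u\<close> have "l < u" by simp
      \<comment> \<open>Interval measures are computed on half-open intervals. The right endpoint
        carries no mass, since \<open>{u - e<..u}\<close> has mass \<open>e\<close> for every
        \<open>e > 0\<close>.\<close>
      have point: "emeasure M {u} \<le> emeasure M {u - e<..u}" if "e > 0" for e
        using that by (intro emeasure_mono) (auto simp: sets_M)
      have "emeasure M {u} \<le> 0 + ennreal e" if "e > 0" for e
        using point[OF that] *[of "u - e" u] that by simp
      then have "emeasure M {u} \<le> 0"
        by (rule ennreal_le_epsilon)
      moreover have "emeasure M {l<..u} = emeasure M {l<..<u} + emeasure M {u}"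
        using \<open>l < u\<close> by (subst plus_emeasure) (auto simp: sets_M intro!: arg_cong[where f = "emeasure M"])
      ultimately show ?thesis
        using *[OF \<open>l \<le> u\<close>] by (simp add: box_real)
    qed simp
  qed (rule sets_M)
  then have "emeasure ?F A = 0" if "A \<in> null_sets lborel" for A
    using that M[of A] by (auto simp: null_sets_def)
  then show ?thesis
    by (auto simp: absolutely_continuous_def null_sets_def)
qed

text \<open>By absolute continuity, Radon-Nikodym supplies a Lebesgue density of the Stieltjes
  measure of \<open>F\<close>, and its integral over an interval is the increment of
  \<open>F\<close>.\<close>

lemma mono_lipschitz_density:
  fixes F :: "real \<Rightarrow> real"
  assumes mono: "\<And>s t. s \<le> t \<Longrightarrow> F s \<le> F t" and lip: "\<And>s t. s \<le> t \<Longrightarrow> F t - F s \<le> t - s"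
  obtains g where "\<And>a b. a \<le> b \<Longrightarrow> (g has_integral (F b - F a)) {a..b}"
proof -
  have F_cont: "continuous (at_right a) F" for a
    using mono_lipschitz_continuous_at_right[OF mono lip] .
  obtain f where f [measurable]: "f \<in> borel_measurable lborel" and f_density: "density lborel f = interval_measure F"
    using sigma_finite_measure.Radon_Nikodym[OF sigma_finite_lborel mono_lipschitz_absolutely_continuous[of F]] mono lip by auto
  \<comment> \<open>Sigma-finiteness forces the density to be finite almost everywhere, so
    \<open>enn2real\<close> loses nothing under the integral.\<close>
  have "sigma_finite_measure (density lborel f)"
    unfolding f_density by (rule sigma_finite_interval_measure[OF mono F_cont])
  then have fin: "AE t in lborel. f t \<noteq> \<infinity>"
    by (simp add: sigma_finite_measure.sigma_finite_iff_density_finite[OF sigma_finite_lborel])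
  show ?thesis
  proof
    fix a b :: real assume "a \<le> b"
    let ?h = "\<lambda>t. enn2real (f t) * indicator {a<..b} t"
    have "(\<integral>\<^sup>+ t. ennreal (?h t) \<partial>lborel) = (\<integral>\<^sup>+ t. f t * indicator {a<..b} t \<partial>lborel)"
      using fin by (intro nn_integral_cong_AE) (auto elim!: eventually_mono split: split_indicator simp: less_top)
    also have "\<dots> = ennreal (F b - F a)"
      using emeasure_interval_measure_Ioc[OF \<open>a \<le> b\<close> mono F_cont]
      by (simp flip: f_density add: emeasure_density)
    finally have "(?h has_integral (F b - F a)) UNIV"
      using mono[OF \<open>a \<le> b\<close>] by (intro nn_integral_has_integral) auto
    then have "((\<lambda>t. if t \<in> {a<..b} then enn2real (f t) else 0) has_integral (F b - F a)) UNIV"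
      by (rule has_integral_cong[THEN iffD1, rotated]) auto
    then have "((\<lambda>t. enn2real (f t)) has_integral (F b - F a)) {a<..b}"
      by (simp only: has_integral_restrict_UNIV)
    then show "((\<lambda>t. enn2real (f t)) has_integral (F b - F a)) {a..b}"
      by (rule has_integral_spike_set_eq[THEN iffD1, rotated 2])
         (auto intro: negligible_subset[of "{a}"])
  qed
qed

text \<open>\<open>F\<close> is an indefinite integral, so Lebesgue differentiation applies.
  \<open>integrable_ccontinuous_explicit\<close> treats averages over intervals to the right of a
  point; left difference quotients come from applying it to the reflected density.\<close>

lemma mono_lipschitz_differentiable_AE:
  fixes F :: "real \<Rightarrow> real"
  assumes mono: "\<And>s t. s \<le> t \<Longrightarrow> F s \<le> F t" and lip: "\<And>s t. s \<le> t \<Longrightarrow> F t - F s \<le> t - s"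
  shows "AE t in lebesgue. \<exists>D. (F has_real_derivative D) (at t)"
proof -
  obtain g where g: "\<And>a b. a \<le> b \<Longrightarrow> (g has_integral (F b - F a)) {a..b}"
    using mono_lipschitz_density[OF mono lip] by blast
  have g_refl: "((\<lambda>t. g (- t)) has_integral (F (- a) - F (- b))) {a..b}" if "a \<le> b" for a b
    using g[of "- b" "- a"] that by (subst has_integral_reflect_real[symmetric]) simp
  have "g integrable_on cbox a b" for a b
    using g[of a b] by (cases "a \<le> b") (auto simp: has_integral_integrable)
  from integrable_ccontinuous_explicit[OF this] obtain N1 where N1: "negligible N1"
    and 1: "\<And>t e. t \<notin> N1 \<Longrightarrow> 0 < e \<Longrightarrow> \<exists>d>0. \<forall>h. 0 < h \<and> h < d \<longrightarrow>
       norm (integral (cbox t (t + h *\<^sub>R One)) g /\<^sub>R h ^ DIM(real) - g t) < e"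
    by metis
  have "(\<lambda>t. g (- t)) integrable_on cbox a b" for a b
    using g_refl[of a b] by (cases "a \<le> b") (auto simp: has_integral_integrable)
  from integrable_ccontinuous_explicit[OF this] obtain N2 where N2: "negligible N2"
    and 2: "\<And>t e. t \<notin> N2 \<Longrightarrow> 0 < e \<Longrightarrow> \<exists>d>0. \<forall>h. 0 < h \<and> h < d \<longrightarrow>
       norm (integral (cbox t (t + h *\<^sub>R One)) (\<lambda>t. g (- t)) /\<^sub>R h ^ DIM(real) - g (- t)) < e"
    by metis
  \<comment> \<open>A point \<open>t\<close> is good if \<open>t\<close> avoids \<open>N1\<close>
    and \<open>- t\<close> avoids \<open>N2\<close>. The mirror image of \<open>N2\<close> is
    negligible as a differentiable image.\<close>
  have neg: "negligible (N1 \<union> uminus ` N2)"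
    using N1 negligible_differentiable_image_negligible[OF order_refl N2, of uminus]
    by (simp add: differentiable_on_minus differentiable_on_ident)
  have "(F has_real_derivative g t) (at t)" if "t \<notin> N1 \<union> uminus ` N2" for t
    unfolding DERIV_def LIM_def
  proof (intro allI impI)
    fix e :: real assume "e > 0"
    have t: "t \<notin> N1" "- t \<notin> N2"
      using that by (auto simp: image_iff)
    obtain d1 where d1: "d1 > 0" "\<And>h. 0 < h \<Longrightarrow> h < d1 \<Longrightarrow> \<bar>(F (t + h) - F t) / h - g t\<bar> < e"
      using 1[OF t(1) \<open>e > 0\<close>] integral_unique[OF g] by (auto simp: divide_inverse mult.commute)
    obtain d2 where d2: "d2 > 0" "\<And>h. 0 < h \<Longrightarrow> h < d2 \<Longrightarrow> \<bar>(F t - F (t - h)) / h - g t\<bar> < e"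
      using 2[OF t(2) \<open>e > 0\<close>] integral_unique[OF g_refl] by (auto simp: divide_inverse mult.commute)
    have "\<bar>(F (t + h) - F t) / h - g t\<bar> < e" if "h \<noteq> 0" "\<bar>h\<bar> < min d1 d2" for h
      using that d1(2)[of h] d2(2)[of "- h"] by (cases "h > 0") (auto simp: minus_divide_left)
    then show "\<exists>s>0. \<forall>h. h \<noteq> 0 \<and> dist h 0 < s \<longrightarrow> dist ((F (t + h) - F t) / h) (g t) < e"
      using d1(1) d2(1) by (intro exI[of _ "min d1 d2"]) (auto simp: dist_real_def)
  qed
  then show ?thesis
    using neg by (intro AE_I'[of "N1 \<union> uminus ` N2"]) (auto simp: negligible_iff_null_sets)
qed

subsection \<open>Existence of solutions\<close>

lemma has_vector_derivative_bound:
  fixes f :: "real \<Rightarrow> 'a::real_normed_vector"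
  assumes "convex S" and der: "\<And>t. t \<in> S \<Longrightarrow> (f has_vector_derivative f' t) (at t within S)"
    and "\<And>t. t \<in> S \<Longrightarrow> norm (f' t) \<le> B" and "s \<in> S" and "t \<in> S"
  shows "norm (f s - f t) \<le> B * \<bar>s - t\<bar>"
  using differentiable_bound[of S f "\<lambda>t h. h *\<^sub>R f' t" B s t] assms
  by (simp add: has_vector_derivative_def onorm_scaleR_left bounded_linear_ident onorm_id)

lemma Lipschitz_imp_continuous_on:
  fixes u :: "real \<Rightarrow> 'a::real_normed_vector"
  assumes "\<And>s t. s \<in> S \<Longrightarrow> t \<in> S \<Longrightarrow> norm (u s - u t) \<le> M * \<bar>s - t\<bar>"
  shows "continuous_on S u"
proof (rule lipschitz_on_continuous_on)
  have "norm (u s - u t) \<le> \<bar>M\<bar> * \<bar>s - t\<bar>" if "s \<in> S" "t \<in> S" for s t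
    by (rule order_trans[OF assms[OF that]]) (simp add: mult_right_mono)
  then show "\<bar>M\<bar>-lipschitz_on S u"
    by (intro lipschitz_onI) (auto simp: dist_norm)
qed

text \<open>A common initial value and a common Lipschitz constant give uniform boundedness and
  equicontinuity; the Lipschitz bound survives pointwise limits.\<close>

lemma Lipschitz_Arzela_Ascoli:
  fixes u :: "nat \<Rightarrow> real \<Rightarrow> 'a::{real_normed_vector,heine_borel}"
  assumes "a \<le> b" and initial: "\<And>n. u n a = x0"
    and lip: "\<And>n s t. s \<in> {a..b} \<Longrightarrow> t \<in> {a..b} \<Longrightarrow> norm (u n s - u n t) \<le> M * \<bar>s - t\<bar>"
  obtains v and r :: "nat \<Rightarrow> nat" where "strict_mono r"
    "\<And>e. e > 0 \<Longrightarrow> \<exists>n0. \<forall>n\<ge>n0. \<forall>t\<in>{a..b}. norm (u (r n) t - v t) < e"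
    "\<And>s t. s \<in> {a..b} \<Longrightarrow> t \<in> {a..b} \<Longrightarrow> norm (v s - v t) \<le> M * \<bar>s - t\<bar>"
proof -
  \<comment> \<open>\<open>M\<close> may be negative when \<open>a = b\<close>, so the estimates run
    with its absolute value.\<close>
  have lip': "norm (u n s - u n t) \<le> \<bar>M\<bar> * \<bar>s - t\<bar>" if "s \<in> {a..b}" "t \<in> {a..b}" for n s t
    by (rule order_trans[OF lip[OF that]]) (simp add: mult_right_mono)
  obtain v r where r: "strict_mono (r :: nat \<Rightarrow> nat)"
    and conv: "\<And>e. 0 < e \<Longrightarrow> \<exists>n0. \<forall>n t. n \<ge> n0 \<and> t \<in> {a..b} \<longrightarrow> norm (u (r n) t - v t) < e"
  proof (rule Arzela_Ascoli[of "{a..b}" u "norm x0 + \<bar>M\<bar> * (b - a)"])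
    fix n t assume t: "t \<in> {a..b}"
    have "norm (u n t) \<le> norm x0 + norm (u n t - u n a)"
      using norm_triangle_ineq[of x0 "u n t - x0"] by (simp add: initial)
    also have "\<dots> \<le> norm x0 + \<bar>M\<bar> * \<bar>t - a\<bar>"
      using lip'[of t a n] t by simp
    also have "\<dots> \<le> norm x0 + \<bar>M\<bar> * (b - a)"
      using t by (auto intro!: mult_left_mono)
    finally show "norm (u n t) \<le> norm x0 + \<bar>M\<bar> * (b - a)" .
  next
    fix t e :: real assume t: "t \<in> {a..b}" "0 < e"
    show "\<exists>d>0. \<forall>n s. s \<in> {a..b} \<and> norm (t - s) < d \<longrightarrow> norm (u n t - u n s) < e"
    proof (intro exI conjI allI impI)
      show "e / (\<bar>M\<bar> + 1) > 0"
        using t by simp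
      fix n s assume s: "s \<in> {a..b} \<and> norm (t - s) < e / (\<bar>M\<bar> + 1)"
      have "norm (u n t - u n s) \<le> \<bar>M\<bar> * \<bar>t - s\<bar>"
        using lip' s t by simp
      also have "\<dots> \<le> (\<bar>M\<bar> + 1) * \<bar>t - s\<bar>"
        by (simp add: mult_right_mono)
      also have "\<dots> < e"
        using s by (simp add: field_simps)
      finally show "norm (u n t - u n s) < e" .
    qed
  qed (use that in auto)
  have "norm (v s - v t) \<le> M * \<bar>s - t\<bar>" if "s \<in> {a..b}" "t \<in> {a..b}" for s t
  proof -
    have "(\<lambda>n. u (r n) s) \<longlonglongrightarrow> v s" "(\<lambda>n. u (r n) t) \<longlonglongrightarrow> v t"
      using conv that unfolding LIMSEQ_iff by blast+
    then have "(\<lambda>n. norm (u (r n) s - u (r n) t)) \<longlonglongrightarrow> norm (v s - v t)"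
      by (intro tendsto_intros)
    then show ?thesis
      by (rule LIMSEQ_le_const2) (use lip that in blast)
  qed
  then show ?thesis
    using that r conv by (metis (no_types, lifting))
qed

text \<open>Method of steps: the right-hand side at time \<open>t\<close> uses \<open>u\<close> only
  up to \<open>t - \<delta>\<close>, so each application of the operator \<open>P\<close> settles
  the solution on a further interval of length \<open>\<delta>\<close>. For \<open>t \<le> a\<close>
  the integral vanishes, which builds in the constant history \<open>x0\<close>.\<close>

lemma delayed_integral_equation:
  fixes g :: "'a::euclidean_space \<Rightarrow> 'a" and a b :: real
  assumes g: "continuous_on UNIV g" and "\<delta> > 0"
  obtains u where "continuous_on UNIV u" "\<And>t. t \<le> b \<Longrightarrow> u t = x0 + integral {a..t} (\<lambda>s. g (u (s - \<delta>)))"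
proof -
  define P where "P u t = x0 + integral {a..t} (\<lambda>s. g (u (s - \<delta>)))" for u t
  define p where "p n = (P ^^ n) (\<lambda>_. x0)" for n
  have degenerate: "integral {a..t} h = 0" if "t \<le> a" for t and h :: "real \<Rightarrow> 'a"
    using that by (cases "t = a") auto
  have P_cont: "continuous_on UNIV (P u)" if u: "continuous_on UNIV u" for u
  proof -
    have gu: "continuous_on S (\<lambda>s. g (u (s - \<delta>)))" for S
      by (rule continuous_on_subset[of UNIV])
         (auto intro!: continuous_on_compose2[OF g] continuous_on_compose2[OF u] continuous_intros)
    have "continuous_on {..a} (P u)"
      by (rule continuous_on_eq[of _ "\<lambda>_. x0"])
         (auto simp: P_def degenerate)
    \<comment> \<open>Indefinite integrals are continuous on compact intervals, so continuity on the
      ray is checked pointwise in the window \<open>{a..t + 1}\<close>.\<close>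
    moreover have "continuous (at t within {a..}) (P u)" if "t \<ge> a" for t
    proof -
      have "continuous_on {a..t + 1} (P u)"
        unfolding P_def
        by (intro continuous_intros indefinite_integral_continuous_1 integrable_continuous_real gu)
      moreover have "at t within {a..t + 1} = at t within {a..}"
        using that by (intro at_within_nhd[of _ "{..<t + 1}"]) auto
      ultimately show ?thesis
        using that by (force simp: continuous_on_eq_continuous_within)
    qed
    then have "continuous_on {a..} (P u)"
      by (simp add: continuous_on_eq_continuous_within)
    ultimately have "continuous_on ({..a} \<union> {a..}) (P u)"
      by (intro continuous_on_closed_Un) auto
    then show ?thesis
      by (rule continuous_on_subset) auto
  qed
  have p_Suc: "p (Suc n) = P (p n)" for n
    by (simp add: p_def)
  have p_cont: "continuous_on UNIV (p n)" for n
    by (induction n) (auto simp: p_Suc P_cont, simp add: p_def)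
  \<comment> \<open>For \<open>t \<le> a + (n + 1) * \<delta>\<close> the integrand sees only
    arguments up to \<open>a + n * \<delta>\<close>, where the two preceding iterates agree. The
    base case compares constant histories.\<close>
  have stable: "p (Suc n) t = p n t" if "t \<le> a + n * \<delta>" for n t
    using that
  proof (induction n arbitrary: t)
    case 0
    then show ?case
      by (simp add: p_def P_def degenerate)
  next
    case (Suc n)
    have "integral {a..t} (\<lambda>s. g (p (Suc n) (s - \<delta>))) = integral {a..t} (\<lambda>s. g (p n (s - \<delta>)))"
    proof (rule integral_cong)
      fix s assume "s \<in> {a..t}"
      then have "s - \<delta> \<le> a + n * \<delta>"
        using Suc.prems by (auto simp: algebra_simps)
      then show "g (p (Suc n) (s - \<delta>)) = g (p n (s - \<delta>))"
        using Suc.IH by simp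
    qed
    then show ?case
      unfolding p_Suc[of "Suc n"] p_Suc[of n] by (simp add: P_def)
  qed
  obtain n :: nat where "b - a \<le> n * \<delta>"
    using reals_Archimedean3[OF \<open>\<delta> > 0\<close>] by (meson less_imp_le)
  then have "p n t = x0 + integral {a..t} (\<lambda>s. g (p n (s - \<delta>)))" if "t \<le> b" for t
    using stable[of t n] that by (simp add: p_Suc P_def)
  then show ?thesis
    using that p_cont by blast
qed

text \<open>Tonelli's proof: the solutions of the equations with delay \<open>1 / (n + 1)\<close> are equi-Lipschitz.\<close>

theorem Peano_existence:
  fixes g :: "'a::euclidean_space \<Rightarrow> 'a" and a b :: real
  assumes g: "continuous_on UNIV g" and bound: "\<And>x. norm (g x) \<le> M"
  obtains u where "u a = x0" "\<And>t. t \<in> {a..b} \<Longrightarrow> (u has_vector_derivative g (u t)) (at t within {a..b})"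
proof -
  have "M \<ge> 0"
    using bound norm_ge_zero order_trans by blast
  define \<delta> where "\<delta> n = inverse (real (Suc n))" for n
  have \<delta>_pos: "\<delta> n > 0" for n
    by (simp add: \<delta>_def)
  have "\<exists>u. continuous_on UNIV u \<and> (\<forall>t\<le>b. u t = x0 + integral {a..t} (\<lambda>s. g (u (s - \<delta> n))))" for n
    using delayed_integral_equation[OF g \<delta>_pos] by metis
  then obtain u where u_cont: "\<And>n. continuous_on UNIV (u n)"
    and u: "\<And>n t. t \<le> b \<Longrightarrow> u n t = x0 + integral {a..t} (\<lambda>s. g (u n (s - \<delta> n)))"
    by metis
  have gu_cont: "continuous_on S (\<lambda>s. g (u n (s - \<delta> n)))" for n S
    by (rule continuous_on_subset[of UNIV])
       (auto intro!: continuous_on_compose2[OF g] continuous_on_compose2[OF u_cont] continuous_intros)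
  have initial: "u n t = x0" if "t \<le> a" "a \<le> b" for n t
    using that u[of t n] by (cases "t = a") auto
  have lip1: "norm (u n t - u n s) \<le> M * (t - s)" if "a \<le> s" "s \<le> t" "t \<le> b" for n s t
  proof -
    have "integral {a..s} (\<lambda>r. g (u n (r - \<delta> n))) + integral {s..t} (\<lambda>r. g (u n (r - \<delta> n)))
        = integral {a..t} (\<lambda>r. g (u n (r - \<delta> n)))"
      using that by (intro Henstock_Kurzweil_Integration.integral_combine integrable_continuous_real gu_cont)
    then have "u n t - u n s = integral {s..t} (\<lambda>r. g (u n (r - \<delta> n)))"
      using that by (simp add: u algebra_simps)
    then show ?thesis
      using integral_bound[OF that(2) gu_cont bound] by simp
  qed
  \<comment> \<open>The delayed argument \<open>t - \<delta> n\<close> can lie before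
    \<open>a\<close>, so the Lipschitz bound is extended to the constant history.\<close>
  have lip2: "norm (u n t - u n s) \<le> M * (t - s)" if "s \<le> t" "t \<le> b" "a \<le> b" for n s t
  proof (cases "a \<le> s"; cases "a \<le> t")
    assume "\<not> a \<le> s" "a \<le> t"
    then have "norm (u n t - u n s) \<le> M * (t - a)"
      using lip1[of a t n] that by (simp add: initial)
    also have "\<dots> \<le> M * (t - s)"
      using \<open>\<not> a \<le> s\<close> \<open>M \<ge> 0\<close> by (intro mult_left_mono) auto
    finally show ?thesis .
  qed (use that lip1 \<open>M \<ge> 0\<close> in \<open>auto simp: initial\<close>)
  show ?thesis
  proof (cases "a \<le> b")
    case True
    have lip: "norm (u n s - u n t) \<le> M * \<bar>s - t\<bar>" if "s \<le> b" "t \<le> b" for n s t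
      using lip2[of s t n] lip2[of t s n] that True by (auto simp: abs_if norm_minus_commute not_less)
    obtain v k where k: "strict_mono (k :: nat \<Rightarrow> nat)"
      and conv: "\<And>e. 0 < e \<Longrightarrow> \<exists>n0. \<forall>n\<ge>n0. \<forall>t\<in>{a..b}. norm (u (k n) t - v t) < e"
      and v_lip: "\<And>s t. s \<in> {a..b} \<Longrightarrow> t \<in> {a..b} \<Longrightarrow> norm (v s - v t) \<le> M * \<bar>s - t\<bar>"
    proof (rule Lipschitz_Arzela_Ascoli[OF True, of u x0 M])
      show "u n a = x0" for n
        using initial True by simp
      show "norm (u n s - u n t) \<le> M * \<bar>s - t\<bar>" if "s \<in> {a..b}" "t \<in> {a..b}" for n s t
        using lip that by simp
    qed (rule that)
    have v_cont: "continuous_on {a..b} v"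
      using v_lip by (rule Lipschitz_imp_continuous_on)
    have ptw: "(\<lambda>n. u (k n) t) \<longlonglongrightarrow> v t" if "t \<in> {a..b}" for t
      using conv that unfolding LIMSEQ_iff by blast
    have \<delta>_lim: "(\<lambda>n. \<delta> (k n)) \<longlonglongrightarrow> 0"
      using LIMSEQ_subseq_LIMSEQ[OF LIMSEQ_inverse_real_of_nat k] by (simp add: \<delta>_def o_def)
    \<comment> \<open>By the common Lipschitz bound the delay changes the value by at most
      \<open>M * \<delta> (k n)\<close>, which tends to 0.\<close>
    have delayed: "(\<lambda>n. u (k n) (t - \<delta> (k n))) \<longlonglongrightarrow> v t" if "t \<in> {a..b}" for t
    proof -
      have "norm (u (k n) (t - \<delta> (k n)) - u (k n) t) \<le> M * \<delta> (k n)" for n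
        using lip[of "t - \<delta> (k n)" t "k n"] that \<delta>_pos[of "k n"] by (auto simp: abs_if)
      moreover have "(\<lambda>n. M * \<delta> (k n)) \<longlonglongrightarrow> 0"
        using tendsto_mult_left[OF \<delta>_lim, of M] by simp
      ultimately have "(\<lambda>n. u (k n) (t - \<delta> (k n)) - u (k n) t) \<longlonglongrightarrow> 0"
        by (rule Lim_null_comparison[OF always_eventually[OF allI]])
      from tendsto_add[OF this ptw[OF that]] show ?thesis
        by simp
    qed
    have v: "v t = x0 + integral {a..t} (\<lambda>s. g (v s))" if t: "t \<in> {a..b}" for t
    proof -
      have "(\<lambda>n. integral {a..t} (\<lambda>s. g (u (k n) (s - \<delta> (k n))))) \<longlonglongrightarrow> integral {a..t} (\<lambda>s. g (v s))"
      proof (rule dominated_convergence)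
        show "(\<lambda>s. g (u (k n) (s - \<delta> (k n)))) integrable_on {a..t}" for n
          by (intro integrable_continuous_real gu_cont)
        show "(\<lambda>n. g (u (k n) (s - \<delta> (k n)))) \<longlonglongrightarrow> g (v s)" if "s \<in> {a..t}" for s
          using g that t by (intro continuous_on_tendsto_compose[OF g delayed]) auto
      qed (use bound in auto)
      then have "(\<lambda>n. u (k n) t) \<longlonglongrightarrow> x0 + integral {a..t} (\<lambda>s. g (v s))"
        using t by (subst u) (auto intro!: tendsto_intros)
      then show ?thesis
        using LIMSEQ_unique ptw[OF t] by blast
    qed
    show ?thesis
    proof
      show "v a = x0"
        using v[of a] True by simp
      fix t assume t: "t \<in> {a..b}"
      have "continuous_on {a..b} (\<lambda>s. g (v s))"
        using continuous_on_compose2[OF g v_cont] by simp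
      then have "((\<lambda>t. x0 + integral {a..t} (\<lambda>s. g (v s))) has_vector_derivative g (v t)) (at t within {a..b})"
        using integral_has_vector_derivative[OF _ t]
        by (auto intro!: derivative_eq_intros)
      then show "(v has_vector_derivative g (v t)) (at t within {a..b})"
        by (rule has_vector_derivative_transform[OF t, rotated]) (use v in auto)
    qed
  qed (use that[of "\<lambda>_. x0"] in auto)
qed

subsection \<open>Limits of solutions of regularized systems\<close>

lemma transition_function_bounds:
  assumes "transition_function \<phi>"
  shows "-1 \<le> \<phi> s" and "\<phi> s \<le> 1"
proof -
  consider "s \<ge> 1" | "s \<le> -1" | "s \<in> {-1<..<1}"
    by fastforce
  then have "-1 \<le> \<phi> s \<and> \<phi> s \<le> 1"
  proof cases
    case 3
    then have "\<phi> s \<in> {-1<..<1}"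
      using assms unfolding transition_function_def by blast
    then show ?thesis
      by simp
  qed (use assms in \<open>simp_all add: transition_function_def\<close>)
  then show "-1 \<le> \<phi> s" and "\<phi> s \<le> 1"
    by auto
qed

text \<open>The increment bounds say that \<open>\<Lambda> s - l * s\<close> and
  \<open>m * s - \<Lambda> s\<close> are nondecreasing near \<open>t\<close>, so their derivatives
  there are nonnegative.\<close>

lemma has_real_derivative_increment_bounds:
  fixes \<Lambda> :: "real \<Rightarrow> real"
  assumes "(\<Lambda> has_real_derivative d) (at t)" and "\<delta> > 0"
    and "\<And>s s'. s \<in> ball t \<delta> \<Longrightarrow> s' \<in> ball t \<delta> \<Longrightarrow> s \<le> s' \<Longrightarrow>
           l * (s' - s) \<le> \<Lambda> s' - \<Lambda> s \<and> \<Lambda> s' - \<Lambda> s \<le> m * (s' - s)"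
  shows "l \<le> d" and "d \<le> m"
proof -
  have t: "t \<in> interior (ball t \<delta>)"
    using \<open>\<delta> > 0\<close> by (simp add: interior_open)
  have "mono_on (ball t \<delta>) (\<lambda>s. \<Lambda> s - l * s)"
    using assms(3) by (intro mono_onI) (force simp: algebra_simps)
  moreover have "((\<lambda>s. \<Lambda> s - l * s) has_real_derivative d - l) (at t)"
    using assms(1) by (auto intro!: derivative_eq_intros)
  ultimately show "l \<le> d"
    using mono_on_imp_deriv_nonneg t by fastforce
  have "mono_on (ball t \<delta>) (\<lambda>s. m * s - \<Lambda> s)"
    using assms(3) by (intro mono_onI) (force simp: algebra_simps)
  moreover have "((\<lambda>s. m * s - \<Lambda> s) has_real_derivative m - d) (at t)"
    using assms(1) by (auto intro!: derivative_eq_intros)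
  ultimately show "d \<le> m"
    using mono_on_imp_deriv_nonneg t by fastforce
qed

text \<open>The weights need not converge as \<open>\<epsilon> k\<close> tends to 0, but their
  integrals are equi-Lipschitz. Where the limit of these integrals has derivative \<open>d\<close>,
  freezing \<open>fp\<close> and \<open>fm\<close> at \<open>z t\<close> shows that \<open>z\<close>
  has derivative \<open>(1 - d) fp + d fm\<close>. If \<open>H (z t)\<close> is nonzero, the weights
  near \<open>t\<close> are eventually constantly 0 or 1, which fixes \<open>d\<close>.\<close>

lemma regularization_solutions_limit:
  fixes fp fm :: "real^'n \<Rightarrow> real^'n" and H :: "real^'n \<Rightarrow> real" and u :: "nat \<Rightarrow> real \<Rightarrow> real^'n"
  assumes fp: "continuous_on UNIV fp" and fm: "continuous_on UNIV fm" and H: "continuous_on UNIV H"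
    and fp_bound: "\<And>p. norm (fp p) \<le> M" and fm_bound: "\<And>p. norm (fm p) \<le> M"
    and \<phi>: "transition_function \<phi>"
    and eps_pos: "\<And>k. \<epsilon> k > 0" and eps: "\<epsilon> \<longlonglongrightarrow> 0"
    and "a \<le> b" and initial: "\<And>k. u k a = x0"
    and u: "\<And>k t. t \<in> {a..b} \<Longrightarrow>
      (u k has_vector_derivative regularization \<phi> fp fm H (\<epsilon> k) (u k t)) (at t within {a..b})"
  obtains z and r :: "nat \<Rightarrow> nat" where "strict_mono r"
    "\<And>e. e > 0 \<Longrightarrow> \<exists>n0. \<forall>n\<ge>n0. \<forall>t\<in>{a..b}. norm (u (r n) t - z t) < e"
    "\<And>s t. s \<in> {a..b} \<Longrightarrow> t \<in> {a..b} \<Longrightarrow> norm (z s - z t) \<le> (M + 1) * \<bar>s - t\<bar>"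
    "AE t in lebesgue. t \<in> {a..b} \<longrightarrow>
       (\<exists>v\<in>filippov_field fp fm H (z t). (z has_vector_derivative v) (at t within {a..b}))"
proof -
  \<comment> \<open>The weight of \<open>fm\<close> in the regularized field: 0 where
    \<open>H \<ge> \<epsilon> k\<close> and 1 where \<open>H \<le> - \<epsilon> k\<close>.\<close>
  define w where "w k s = 1/2 * (1 - \<phi> (H (u k s) / \<epsilon> k))" for k s
  have w_nonneg: "0 \<le> w k s" and w_le_1: "w k s \<le> 1" for k s
    using transition_function_bounds[OF \<phi>, of "H (u k s) / \<epsilon> k"] by (auto simp: w_def)
  have u': "(u k has_vector_derivative (1 - w k t) *\<^sub>R fp (u k t) + w k t *\<^sub>R fm (u k t)) (at t within {a..b})"
    if "t \<in> {a..b}" for k t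
  proof -
    have eq: "1/2 * (1 + \<phi> (H (u k t) / \<epsilon> k)) = 1 - w k t"
      by (simp add: w_def field_simps)
    show ?thesis
      using u[OF that, of k] unfolding regularization_def eq w_def[symmetric] .
  qed
  have convex_bound: "norm ((1 - w k t) *\<^sub>R p + w k t *\<^sub>R q) \<le> e" if "norm p \<le> e" "norm q \<le> e" for p q :: "real^'n" and k t e
    using convexD_alt[OF convex_cball[of 0 e], of p q "w k t"] that w_nonneg w_le_1 by simp
  have u_cont: "continuous_on {a..b} (u k)" for k
    using u by (meson continuous_on_eq_continuous_within has_vector_derivative_continuous)
  have \<phi>_cont: "continuous_on UNIV \<phi>"
    using \<phi> by (simp add: transition_function_def)
  have w_cont: "continuous_on {a..b} (w k)" for k
    unfolding w_def using eps_pos[of k]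
    by (auto intro!: continuous_intros continuous_on_compose2[OF \<phi>_cont] continuous_on_compose2[OF H u_cont])
  \<comment> \<open>The accumulated weight of \<open>fm\<close>. Its uniform limit is 1-Lipschitz and nondecreasing, hence differentiable
    almost everywhere, and the derivative is the convex coefficient in the Filippov inclusion.\<close>
  define \<Lambda> where "\<Lambda> k t = integral {a..t} (w k)" for k t
  have \<Lambda>: "(\<Lambda> k has_vector_derivative w k t) (at t within {a..b})" if "t \<in> {a..b}" for k t
    unfolding \<Lambda>_def by (rule integral_has_vector_derivative[OF w_cont that])
  have \<Lambda>_diff: "l * (s' - s) \<le> \<Lambda> k s' - \<Lambda> k s \<and> \<Lambda> k s' - \<Lambda> k s \<le> m * (s' - s)"
    if "a \<le> s" "s \<le> s'" "s' \<le> b" "\<And>r. r \<in> {s..s'} \<Longrightarrow> l \<le> w k r \<and> w k r \<le> m" for k s s' l m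
  proof -
    have int: "w k integrable_on {c..d}" if "a \<le> c" "d \<le> b" for c d
      using that by (intro integrable_continuous_real continuous_on_subset[OF w_cont]) auto
    have "integral {a..s} (w k) + integral {s..s'} (w k) = integral {a..s'} (w k)"
      using that by (intro Henstock_Kurzweil_Integration.integral_combine int) auto
    then have "\<Lambda> k s' - \<Lambda> k s = integral {s..s'} (w k)"
      by (simp add: \<Lambda>_def)
    moreover have "integral {s..s'} (\<lambda>_. l) \<le> integral {s..s'} (w k)"
      by (rule integral_le) (use that in \<open>auto intro: int\<close>)
    moreover have "integral {s..s'} (w k) \<le> integral {s..s'} (\<lambda>_. m)"
      by (rule integral_le) (use that in \<open>auto intro: int\<close>)
    ultimately show ?thesis
      using that by (simp add: mult.commute)
  qed
  have u_lip: "norm (u k s - u k t) \<le> M * \<bar>s - t\<bar>" if "s \<in> {a..b}" "t \<in> {a..b}" for k s t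
    using has_vector_derivative_bound[OF _ u' _ that, of _ M] convex_bound fp_bound fm_bound by simp
  have \<Lambda>_lip: "\<bar>\<Lambda> k s - \<Lambda> k t\<bar> \<le> 1 * \<bar>s - t\<bar>" if "s \<in> {a..b}" "t \<in> {a..b}" for k s t
    using has_vector_derivative_bound[OF _ \<Lambda> _ that, of _ 1] w_nonneg w_le_1 by simp
  \<comment> \<open>Applying Arzela-Ascoli to the pair gives one subsequence for trajectories and
    accumulated weights. \<open>M + 1\<close> is the sum of their Lipschitz constants.\<close>
  obtain p r where r: "strict_mono (r :: nat \<Rightarrow> nat)"
    and p: "\<And>e. e > 0 \<Longrightarrow> \<exists>n0. \<forall>n\<ge>n0. \<forall>t\<in>{a..b}. norm ((u (r n) t, \<Lambda> (r n) t) - p t) < e"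
    and p_lip: "\<And>s t. s \<in> {a..b} \<Longrightarrow> t \<in> {a..b} \<Longrightarrow> norm (p s - p t) \<le> (M + 1) * \<bar>s - t\<bar>"
  proof (rule Lipschitz_Arzela_Ascoli[OF \<open>a \<le> b\<close>, of "\<lambda>k t. (u k t, \<Lambda> k t)" "(x0, 0)" "M + 1"])
    show "(u k a, \<Lambda> k a) = (x0, 0)" for k
      by (simp add: initial \<Lambda>_def)
    show "norm ((u k s, \<Lambda> k s) - (u k t, \<Lambda> k t)) \<le> (M + 1) * \<bar>s - t\<bar>" if "s \<in> {a..b}" "t \<in> {a..b}" for k s t
      using norm_Pair_le[of "u k s - u k t" "\<Lambda> k s - \<Lambda> k t"] u_lip[OF that, of k] \<Lambda>_lip[OF that, of k]
      by (simp add: algebra_simps)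
  qed (rule that)
  define z where "z t = fst (p t)" for t
  define L where "L t = snd (p t)" for t
  have z_conv: "\<exists>n0. \<forall>n\<ge>n0. \<forall>t\<in>{a..b}. norm (u (r n) t - z t) < e" if "e > 0" for e
  proof -
    have "norm (u (r n) t - z t) \<le> norm ((u (r n) t, \<Lambda> (r n) t) - p t)" for n t
      using norm_fst_le[of "u (r n) t - z t" "\<Lambda> (r n) t - snd (p t)"] by (simp add: z_def minus_prod_def)
    then show ?thesis
      using p[OF that] by (meson order_le_less_trans)
  qed
  have z_lip: "norm (z s - z t) \<le> (M + 1) * \<bar>s - t\<bar>" if "s \<in> {a..b}" "t \<in> {a..b}" for s t
    using p_lip[OF that] norm_fst_le[of "z s - z t" "snd (p s) - snd (p t)"] by (simp add: z_def minus_prod_def)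
  have z_cont: "continuous_on {a..b} z"
    using z_lip by (rule Lipschitz_imp_continuous_on)
  have z_lim: "(\<lambda>n. u (r n) t) \<longlonglongrightarrow> z t" and L_lim: "(\<lambda>n. \<Lambda> (r n) t) \<longlonglongrightarrow> L t" if "t \<in> {a..b}" for t
  proof -
    have "(\<lambda>n. (u (r n) t, \<Lambda> (r n) t)) \<longlonglongrightarrow> p t"
      using p that unfolding LIMSEQ_iff by blast
    from tendsto_fst[OF this] tendsto_snd[OF this]
    show "(\<lambda>n. u (r n) t) \<longlonglongrightarrow> z t" "(\<lambda>n. \<Lambda> (r n) t) \<longlonglongrightarrow> L t"
      by (simp_all add: z_def L_def)
  qed
  \<comment> \<open>Weight bounds valid from some index on survive as increment bounds for
    \<open>L\<close>, even where the weights oscillate.\<close>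
  have L_diff: "l * (s' - s) \<le> L s' - L s \<and> L s' - L s \<le> m * (s' - s)"
    if "a \<le> s" "s \<le> s'" "s' \<le> b" and "\<And>n r'. n \<ge> n0 \<Longrightarrow> r' \<in> {s..s'} \<Longrightarrow> l \<le> w (r n) r' \<and> w (r n) r' \<le> m" for n0 s s' l m
  proof -
    have lim: "(\<lambda>n. \<Lambda> (r n) s' - \<Lambda> (r n) s) \<longlonglongrightarrow> L s' - L s"
      using that by (intro tendsto_intros L_lim) auto
    have "l * (s' - s) \<le> \<Lambda> (r n) s' - \<Lambda> (r n) s \<and> \<Lambda> (r n) s' - \<Lambda> (r n) s \<le> m * (s' - s)" if "n \<ge> n0" for n
      using that \<open>a \<le> s\<close> \<open>s \<le> s'\<close> \<open>s' \<le> b\<close>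
        \<open>\<And>n r'. n \<ge> n0 \<Longrightarrow> r' \<in> {s..s'} \<Longrightarrow> l \<le> w (r n) r' \<and> w (r n) r' \<le> m\<close> by (intro \<Lambda>_diff) auto
    then show ?thesis
      using LIMSEQ_le_const[OF lim] LIMSEQ_le_const2[OF lim] by blast
  qed
  \<comment> \<open>Uniform convergence combined with continuity of \<open>z\<close>: for late
    \<open>n\<close> and \<open>s\<close> near \<open>t\<close>, all points \<open>u (r n) s\<close>
    lie near \<open>z t\<close>.\<close>
  have near: "\<exists>\<delta>>0. \<exists>n0. \<forall>n\<ge>n0. \<forall>s\<in>{a..b} \<inter> ball t \<delta>. norm (h (u (r n) s) - h (z t)) < e"
    if h: "continuous_on UNIV h" and "t \<in> {a..b}" and "e > 0"
    for h :: "real^'n \<Rightarrow> 'b::real_normed_vector" and t e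
  proof -
    obtain d where d: "d > 0" "\<And>q. norm (q - z t) < d \<Longrightarrow> norm (h q - h (z t)) < e"
      using h \<open>e > 0\<close> unfolding continuous_on_iff dist_norm by blast
    obtain \<delta> where \<delta>: "\<delta> > 0" "\<And>s. s \<in> {a..b} \<Longrightarrow> \<bar>s - t\<bar> < \<delta> \<Longrightarrow> norm (z s - z t) < d / 2"
      using z_cont \<open>t \<in> {a..b}\<close> half_gt_zero[OF \<open>d > 0\<close>] unfolding continuous_on_iff dist_norm real_norm_def by metis
    obtain n0 where n0: "\<And>n s. n \<ge> n0 \<Longrightarrow> s \<in> {a..b} \<Longrightarrow> norm (u (r n) s - z s) < d / 2"
      using z_conv[OF half_gt_zero[OF \<open>d > 0\<close>]] by blast
    have "norm (h (u (r n) s) - h (z t)) < e" if "n \<ge> n0" "s \<in> {a..b} \<inter> ball t \<delta>" for n s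
    proof -
      have "norm (z s - z t) < d / 2" "norm (u (r n) s - z s) < d / 2"
        using that \<delta>(2)[of s] n0 by (auto simp: dist_real_def abs_minus_commute)
      then have "norm (u (r n) s - z t) < d"
        using norm_triangle_ineq[of "u (r n) s - z s" "z s - z t"] by simp
      then show ?thesis
        by (rule d(2))
    qed
    then show ?thesis
      using \<delta>(1) by blast
  qed
  have L_mono: "L s \<le> L s'" "L s' - L s \<le> s' - s" if "a \<le> s" "s \<le> s'" "s' \<le> b" for s s'
    using L_diff[OF that, of 0 0 1] w_nonneg w_le_1 by auto
  \<comment> \<open>Clamping the argument to \<open>{a..b}\<close> extends \<open>L\<close> to the
    whole line and keeps it nondecreasing and 1-Lipschitz. The endpoints, around which the extension
    need not agree with \<open>L\<close>, are discarded as a null set.\<close>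
  have "AE t in lebesgue. \<exists>d. ((\<lambda>t. L (max a (min b t))) has_real_derivative d) (at t)"
    using \<open>a \<le> b\<close>
    by (intro mono_lipschitz_differentiable_AE L_mono order_trans[OF L_mono(2)]) (auto simp: max_def min_def)
  moreover have "AE t in lebesgue. t \<notin> {a, b}"
    by (intro AE_not_in) (simp add: negligible_iff_null_sets[symmetric])
  ultimately have ae: "AE t in lebesgue. t \<in> {a..b} \<longrightarrow>
    (\<exists>v\<in>filippov_field fp fm H (z t). (z has_vector_derivative v) (at t within {a..b}))"
  proof eventually_elim
    case (elim t)
    show ?case
    proof
      assume t: "t \<in> {a..b}"
      obtain d where "((\<lambda>t. L (max a (min b t))) has_real_derivative d) (at t)"
        using elim(1) by blast
      then have d: "(L has_real_derivative d) (at t)"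
        by (rule DERIV_cong_ev[THEN iffD1, rotated 3])
           (use elim(2) t in \<open>auto simp: max_def min_def intro!: eventually_nhds_in_open[of "{a<..<b}", THEN eventually_mono]\<close>)
      have d_bounds: "l \<le> d \<and> d \<le> m"
        if "\<delta> > 0" "\<And>n s. n \<ge> n0 \<Longrightarrow> s \<in> {a..b} \<inter> ball t \<delta> \<Longrightarrow> l \<le> w (r n) s \<and> w (r n) s \<le> m" for \<delta> n0 l m
      proof -
        \<comment> \<open>The smaller radius keeps the ball inside \<open>{a..b}\<close>; it is
          positive because \<open>t\<close> is not an endpoint.\<close>
        define \<eta> where "\<eta> = min \<delta> (min (t - a) (b - t))"
        have "\<eta> > 0"
          using elim(2) t \<open>\<delta> > 0\<close> by (auto simp: \<eta>_def)
        have sub: "s \<in> {a..b} \<inter> ball t \<delta>" if "s \<in> ball t \<eta>" for s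
          using that by (auto simp: \<eta>_def dist_real_def)
        have "l * (s' - s) \<le> L s' - L s \<and> L s' - L s \<le> m * (s' - s)"
          if s: "s \<in> ball t \<eta>" "s' \<in> ball t \<eta>" "s \<le> s'" for s s'
        proof (rule L_diff[of s s' n0])
          show "l \<le> w (r n) r' \<and> w (r n) r' \<le> m" if "n \<ge> n0" "r' \<in> {s..s'}" for n r'
          proof (rule \<open>\<And>n s. n \<ge> n0 \<Longrightarrow> s \<in> {a..b} \<inter> ball t \<delta> \<Longrightarrow> l \<le> w (r n) s \<and> w (r n) s \<le> m\<close>[OF that(1) sub])
            show "r' \<in> ball t \<eta>"
              using s that by (auto simp: dist_real_def)
          qed
        qed (use sub[OF s(1)] sub[OF s(2)] s in auto)
        then show ?thesis
          using has_real_derivative_increment_bounds[OF d \<open>\<eta> > 0\<close>] by blast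
      qed
      define q where "q s = z s - ((s - t) *\<^sub>R fp (z t) + L s *\<^sub>R (fm (z t) - fp (z t)))" for s
      have "(q has_vector_derivative 0) (at t within {a..b})"
        unfolding has_vector_derivative_def has_derivative_within_alt
      proof (intro conjI allI impI)
        fix e :: real assume "e > 0"
        obtain \<delta>1 n1 where 1: "\<delta>1 > 0" "\<And>n s. n \<ge> n1 \<Longrightarrow> s \<in> {a..b} \<inter> ball t \<delta>1 \<Longrightarrow> norm (fp (u (r n) s) - fp (z t)) < e"
          using near[OF fp t \<open>e > 0\<close>] by metis
        obtain \<delta>2 n2 where 2: "\<delta>2 > 0" "\<And>n s. n \<ge> n2 \<Longrightarrow> s \<in> {a..b} \<inter> ball t \<delta>2 \<Longrightarrow> norm (fm (u (r n) s) - fm (z t)) < e"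
          using near[OF fm t \<open>e > 0\<close>] by metis
        define S where "S = {a..b} \<inter> ball t (min \<delta>1 \<delta>2)"
        \<comment> \<open>The counterpart of \<open>q\<close> for \<open>u (r n)\<close>. Its
          derivative near \<open>t\<close> is a convex combination of two deviations smaller than
          \<open>e\<close>, so the mean value inequality bounds its increments, and the bound passes
          to \<open>q\<close>.\<close>
        define Q where "Q n s = u (r n) s - ((s - t) *\<^sub>R fp (z t) + \<Lambda> (r n) s *\<^sub>R (fm (z t) - fp (z t)))" for n s
        have "norm (q s - q t) \<le> e * \<bar>s - t\<bar>" if s: "s \<in> S" for s
        proof -
          have "t \<in> S"
            using t 1(1) 2(1) by (simp add: S_def)
          have Q: "norm (Q n s - Q n t) \<le> e * \<bar>s - t\<bar>" if n: "n \<ge> max n1 n2" for n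
          proof (rule has_vector_derivative_bound[OF _ _ _ s \<open>t \<in> S\<close>])
            show "convex S"
              by (auto simp: S_def intro!: convex_Int)
            fix s' assume s': "s' \<in> S"
            let ?D = "(1 - w (r n) s') *\<^sub>R (fp (u (r n) s') - fp (z t)) + w (r n) s' *\<^sub>R (fm (u (r n) s') - fm (z t))"
            have "s' \<in> {a..b}"
              using s' by (simp add: S_def)
            then have "(Q n has_vector_derivative ?D) (at s' within {a..b})"
              unfolding Q_def
              by (auto intro!: derivative_eq_intros u' has_vector_derivative_scaleR \<Lambda>[unfolded has_real_derivative_iff_has_vector_derivative[symmetric]]
                  simp: algebra_simps)
            then show "(Q n has_vector_derivative ?D) (at s' within S)"
              by (rule has_vector_derivative_within_subset) (simp add: S_def)
            show "norm ?D \<le> e"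
              using 1(2)[of n s'] 2(2)[of n s'] n s' by (intro convex_bound) (auto simp: S_def)
          qed
          have "(\<lambda>n. norm (Q n s - Q n t)) \<longlonglongrightarrow> norm (q s - q t)"
            unfolding Q_def q_def using s t by (intro tendsto_intros z_lim L_lim) (auto simp: S_def)
          then show ?thesis
            by (rule LIMSEQ_le_const2) (use Q in blast)
        qed
        then show "\<exists>\<delta>>0. \<forall>s\<in>{a..b}. norm (s - t) < \<delta> \<longrightarrow> norm (q s - q t - (s - t) *\<^sub>R 0) \<le> e * norm (s - t)"
          using 1(1) 2(1)
          by (intro exI[of _ "min \<delta>1 \<delta>2"]) (auto simp: S_def dist_real_def abs_minus_commute)
      qed (rule bounded_linear_scaleR_left)
      then have "((\<lambda>s. q s + ((s - t) *\<^sub>R fp (z t) + L s *\<^sub>R (fm (z t) - fp (z t)))) has_vector_derivative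
          (1 - d) *\<^sub>R fp (z t) + d *\<^sub>R fm (z t)) (at t within {a..b})"
        using DERIV_subset[OF d]
        by (auto intro!: derivative_eq_intros has_vector_derivative_scaleR simp: algebra_simps)
      then have z': "(z has_vector_derivative (1 - d) *\<^sub>R fp (z t) + d *\<^sub>R fm (z t)) (at t within {a..b})"
        by (simp add: q_def)
      \<comment> \<open>Off the switching manifold the transition function is eventually saturated
        near \<open>t\<close>: \<open>\<sigma> * H\<close> along the approximations stays above half
        its value at \<open>z t\<close>, while \<open>\<epsilon> (r n)\<close> falls below that
        half. \<open>\<sigma>\<close> is 1 or -1 according to the side.\<close>
      have sign: "\<exists>\<delta>>0. \<exists>n0. \<forall>n\<ge>n0. \<forall>s\<in>{a..b} \<inter> ball t \<delta>. 1 \<le> \<sigma> * H (u (r n) s) / \<epsilon> (r n)"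
        if \<sigma>: "\<sigma> * H (z t) > 0" for \<sigma>
      proof -
        have cont: "continuous_on UNIV (\<lambda>p. \<sigma> * H p)"
          by (intro continuous_intros H)
        have pos: "\<sigma> * H (z t) / 2 > 0"
          using \<sigma> by simp
        obtain \<delta> n1 where 1: "\<delta> > 0" "\<And>n s. n \<ge> n1 \<Longrightarrow> s \<in> {a..b} \<inter> ball t \<delta> \<Longrightarrow>
            \<bar>\<sigma> * H (u (r n) s) - \<sigma> * H (z t)\<bar> < \<sigma> * H (z t) / 2"
          using near[OF cont t pos] unfolding real_norm_def by metis
        obtain n2 where 2: "\<And>n. n \<ge> n2 \<Longrightarrow> \<epsilon> (r n) < \<sigma> * H (z t) / 2"
          using order_tendstoD(2)[OF LIMSEQ_subseq_LIMSEQ[OF eps r] pos] by (auto simp: eventually_sequentially)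
        have "1 \<le> \<sigma> * H (u (r n) s) / \<epsilon> (r n)" if "n \<ge> max n1 n2" "s \<in> {a..b} \<inter> ball t \<delta>" for n s
        proof -
          have "\<epsilon> (r n) < \<sigma> * H (z t) / 2" "\<bar>\<sigma> * H (u (r n) s) - \<sigma> * H (z t)\<bar> < \<sigma> * H (z t) / 2"
            using 1(2)[OF _ that(2), of n] 2[of n] that(1) by auto
          then have "\<epsilon> (r n) \<le> \<sigma> * H (u (r n) s)"
            by linarith
          then show ?thesis
            using eps_pos[of "r n"] by simp
        qed
        then show ?thesis
          using 1(1) by blast
      qed
      have "(1 - d) *\<^sub>R fp (z t) + d *\<^sub>R fm (z t) \<in> filippov_field fp fm H (z t)"
      proof (cases "H (z t)" "0 :: real" rule: linorder_cases)
        case equal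
        have "0 \<le> d \<and> d \<le> 1"
          using d_bounds[of 1 0 0 1] w_nonneg w_le_1 by simp
        then show ?thesis
          using equal by (auto simp: filippov_field_def)
      next
        case greater
        then obtain \<delta> n0 where \<delta>: "\<delta> > 0"
          and "\<And>n s. n \<ge> n0 \<Longrightarrow> s \<in> {a..b} \<inter> ball t \<delta> \<Longrightarrow> 1 \<le> 1 * H (u (r n) s) / \<epsilon> (r n)"
          using sign[of 1] unfolding mult_1 by metis
        then have "w (r n) s = 0" if "n \<ge> n0" "s \<in> {a..b} \<inter> ball t \<delta>" for n s
          using \<phi> that by (simp add: w_def transition_function_def)
        then have "d = 0"
          using d_bounds[OF \<delta>, of n0 0 0] by simp
        then show ?thesis
          using greater by (simp add: filippov_field_def)
      next
        case less
        then obtain \<delta> n0 where \<delta>: "\<delta> > 0"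
          and far: "\<And>n s. n \<ge> n0 \<Longrightarrow> s \<in> {a..b} \<inter> ball t \<delta> \<Longrightarrow> 1 \<le> -1 * H (u (r n) s) / \<epsilon> (r n)"
          using sign[of "-1"] unfolding mult_minus1 neg_0_less_iff_less by metis
        have "w (r n) s = 1" if "n \<ge> n0" "s \<in> {a..b} \<inter> ball t \<delta>" for n s
        proof -
          have "H (u (r n) s) / \<epsilon> (r n) \<le> -1"
            using far[OF that] by simp
          then show ?thesis
            using \<phi> by (simp add: w_def transition_function_def)
        qed
        then have "d = 1"
          using d_bounds[OF \<delta>, of n0 1 1] by simp
        then show ?thesis
          using less by (simp add: filippov_field_def)
      qed
      with z' show "\<exists>v\<in>filippov_field fp fm H (z t). (z has_vector_derivative v) (at t within {a..b})"
        by blast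
    qed
  qed
  show ?thesis
    using that[OF r z_conv z_lip ae] by blast
qed

subsection \<open>Convergence to Filippov solutions\<close>

lemma Lipschitz_imp_absolutely_continuous_on:
  fixes x :: "real \<Rightarrow> 'a::real_normed_vector"
  assumes lip: "\<And>s t. s \<in> S \<Longrightarrow> t \<in> S \<Longrightarrow> norm (x s - x t) \<le> M * \<bar>s - t\<bar>"
  shows "absolutely_continuous_on S x"
  unfolding absolutely_continuous_on_def
proof (intro allI impI)
  fix e :: real assume "e > 0"
  show "\<exists>d>0. \<forall>D. D division_of \<Union>D \<and> \<Union>D \<subseteq> S \<and> (\<Sum>k\<in>D. Sup k - Inf k) < d
    \<longrightarrow> (\<Sum>k\<in>D. norm (x (Sup k) - x (Inf k))) < e"
  proof (intro exI conjI allI impI)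
    show "e / (\<bar>M\<bar> + 1) > 0"
      using \<open>e > 0\<close> by simp
    fix D assume D: "D division_of \<Union>D \<and> \<Union>D \<subseteq> S \<and> (\<Sum>k\<in>D. Sup k - Inf k) < e / (\<bar>M\<bar> + 1)"
    have "norm (x (Sup k) - x (Inf k)) \<le> (\<bar>M\<bar> + 1) * (Sup k - Inf k)" if "k \<in> D" for k
    proof -
      have "k \<noteq> {}" "\<exists>c d. k = cbox c d" "k \<subseteq> S"
        using D that division_ofD(3,4) by blast+
      then obtain c d where k: "k = {c..d}" "c \<le> d"
        by auto
      then have "c \<in> S" "d \<in> S"
        using \<open>k \<subseteq> S\<close> by auto
      then have "norm (x d - x c) \<le> M * \<bar>d - c\<bar>"
        by (intro lip)
      also have "\<dots> \<le> (\<bar>M\<bar> + 1) * (d - c)"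
        using k by (simp add: mult_right_mono)
      finally show ?thesis
        using k by simp
    qed
    then have "(\<Sum>k\<in>D. norm (x (Sup k) - x (Inf k))) \<le> (\<Sum>k\<in>D. (\<bar>M\<bar> + 1) * (Sup k - Inf k))"
      by (rule sum_mono)
    also have "\<dots> = (\<bar>M\<bar> + 1) * (\<Sum>k\<in>D. Sup k - Inf k)"
      by (simp add: sum_distrib_left)
    also have "\<dots> < e"
      using D by (simp add: field_simps)
    finally show "(\<Sum>k\<in>D. norm (x (Sup k) - x (Inf k))) < e" .
  qed
qed

text \<open>Divisions with a single member already control each increment over a short
  interval.\<close>

lemma absolutely_continuous_on_imp_continuous_on:
  assumes "absolutely_continuous_on {a..b} x"
  shows "continuous_on {a..b} x"
  unfolding continuous_on_iff
proof (intro ballI allI impI)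
  fix t e :: real assume t: "t \<in> {a..b}" and "e > 0"
  obtain d where "d > 0" and d: "\<And>D. D division_of \<Union>D \<Longrightarrow> \<Union>D \<subseteq> {a..b} \<Longrightarrow> (\<Sum>k\<in>D. Sup k - Inf k) < d
      \<Longrightarrow> (\<Sum>k\<in>D. norm (x (Sup k) - x (Inf k))) < e"
    using assms[unfolded absolutely_continuous_on_def, rule_format, OF \<open>e > 0\<close>] by metis
  have "norm (x s' - x s) < e" if "a \<le> s" "s \<le> s'" "s' \<le> b" "s' - s < d" for s s'
    using d[of "{{s..s'}}"] that division_of_self[of s s'] by (auto simp: box_real)
  from this[of t] this[of _ t] show "\<exists>d>0. \<forall>s\<in>{a..b}. dist s t < d \<longrightarrow> dist (x s) (x t) < e"
    using \<open>d > 0\<close> t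
    by (intro exI[of _ d]) (auto simp: dist_norm dist_real_def abs_if norm_minus_commute not_less split: if_splits)
qed

text \<open>The compactness arguments need compact time intervals, while \<open>J\<close> may be
  unbounded or half-open.\<close>

lemma filippov_solution_subinterval:
  assumes "filippov_solution U fp fm H t0 J x" and "T \<in> J"
  shows "filippov_solution U fp fm H t0 {t0..T} x"
proof -
  have J: "is_interval J" "t0 \<in> J" "t0 \<le> T"
    using assms by (auto simp: filippov_solution_def forward_interval_def)
  then have sub: "{t0..T} \<subseteq> J"
    using \<open>T \<in> J\<close> by (meson atLeastAtMost_iff mem_is_interval_1_I subsetI)
  have "AE t in lebesgue. t \<in> J \<longrightarrow>
      (\<exists>v\<in>filippov_field fp fm H (x t). (x has_vector_derivative v) (at t within J))"
    using assms by (simp add: filippov_solution_def)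
  then have ae: "AE t in lebesgue. t \<in> {t0..T} \<longrightarrow>
      (\<exists>v\<in>filippov_field fp fm H (x t). (x has_vector_derivative v) (at t within {t0..T}))"
    by eventually_elim (use sub has_vector_derivative_within_subset in blast)
  have U: "\<forall>t\<in>J. x t \<in> U" and ac: "\<forall>a b. {a..b} \<subseteq> J \<longrightarrow> absolutely_continuous_on {a..b} x"
    using assms(1) by (simp_all add: filippov_solution_def)
  show ?thesis
    unfolding filippov_solution_def
  proof (intro conjI allI impI ballI ae)
    show "forward_interval t0 {t0..T}"
      using J by (auto simp: forward_interval_def is_interval_cc)
    show "x t \<in> U" if "t \<in> {t0..T}" for t
      using U sub that by blast
    show "absolutely_continuous_on {a..b} x" if "{a..b} \<subseteq> {t0..T}" for a b
      using ac order_trans[OF that sub] by simp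
  qed
qed

lemma filippov_solution_continuous_on:
  "filippov_solution U fp fm H a {a..b} x \<Longrightarrow> continuous_on {a..b} x"
  by (rule absolutely_continuous_on_imp_continuous_on) (simp add: filippov_solution_def)

lemma C_1_on_imp_continuous_on: "C_k_on 1 h U \<Longrightarrow> continuous_on U h"
  by (auto simp: continuous_on_eq_continuous_within 
      intro: differentiable_at_withinI differentiable_imp_continuous_within)

lemma bimodal_system_continuous_on:
  assumes "bimodal_system U fp fm H"
  shows "continuous_on U fp" "continuous_on U fm" "continuous_on U H"
  using assms unfolding bimodal_system_def smooth_on_def by (blast intro: C_1_on_imp_continuous_on)+

text \<open>Tietze's theorem preserves the bound of \<open>f\<close> on \<open>W\<close>. It turns
  data given on a compact part of \<open>U\<close> into bounded continuous data on the whole space,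
  as \<open>Peano_existence\<close> requires.\<close>

lemma bounded_continuous_extension:
  fixes f :: "'a::euclidean_space \<Rightarrow> 'b::euclidean_space"
  assumes "compact W" and "continuous_on W f"
  obtains g M where "continuous_on UNIV g" "\<And>p. p \<in> W \<Longrightarrow> g p = f p" "\<And>p. norm (g p) \<le> M"
proof -
  have "bounded (f ` W)"
    using assms by (intro compact_imp_bounded compact_continuous_image)
  then obtain B where "B > 0" "\<And>p. p \<in> W \<Longrightarrow> norm (f p) \<le> B"
    unfolding bounded_pos by blast
  moreover have "closedin (top_of_set UNIV) W"
    using compact_imp_closed[OF assms(1)] by simp
  ultimately obtain g where "continuous_on UNIV g" "\<And>p. p \<in> W \<Longrightarrow> g p = f p" "\<And>p. p \<in> UNIV \<Longrightarrow> norm (g p) \<le> B"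
    using Tietze[OF assms(2), of UNIV B] by (metis less_imp_le)
  then show ?thesis
    using that by blast
qed

text \<open>By contradiction: otherwise parameters tending to 0 admit no approximating solution, yet
  solutions of the extended regularized systems have a subsequence converging uniformly to
  \<open>x\<close>.\<close>

lemma regularization_approximates_filippov_solution:
  fixes U :: "(real^'n) set" and x :: "real \<Rightarrow> real^'n"
  assumes sys: "bimodal_system U fp fm H"
    and unique: "right_unique_solutions (filippov_solution U fp fm H)"
    and \<phi>: "transition_function \<phi>"
    and x: "filippov_solution U fp fm H a {a..b} x" and "e > 0"
  obtains \<epsilon>0 where "\<epsilon>0 > 0" "\<And>\<epsilon>. 0 < \<epsilon> \<Longrightarrow> \<epsilon> < \<epsilon>0 \<Longrightarrow>
    \<exists>u. classical_solution U (regularization \<phi> fp fm H \<epsilon>) a {a..b} u \<and> u a = x a \<and> (\<forall>t\<in>{a..b}. norm (u t - x t) < e)"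
proof (rule ccontr)
  let ?approx = "\<lambda>\<epsilon> u. classical_solution U (regularization \<phi> fp fm H \<epsilon>) a {a..b} u \<and> u a = x a \<and>
    (\<forall>t\<in>{a..b}. norm (u t - x t) < e)"
  assume "\<not> thesis"
  then have "\<exists>\<epsilon>>0. \<epsilon> < inverse (real (Suc k)) \<and> \<not> (\<exists>u. ?approx \<epsilon> u)" for k
    using that[of "inverse (real (Suc k))"] by fastforce
  then obtain \<epsilon> where eps_pos: "\<And>k. \<epsilon> k > 0" and eps_le: "\<And>k. \<epsilon> k < inverse (real (Suc k))"
    and no_approx: "\<And>k u. \<not> ?approx (\<epsilon> k) u"
    by metis
  have eps_lim: "\<epsilon> \<longlonglongrightarrow> 0"
    by (rule tendsto_sandwich[OF _ _ tendsto_const LIMSEQ_inverse_real_of_nat])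
       (simp_all add: less_imp_le eps_pos eps_le del: of_nat_Suc)
  have interval: "forward_interval a {a..b}" and xU: "x ` {a..b} \<subseteq> U"
    using x unfolding filippov_solution_def by blast+
  then have "a \<le> b"
    by (simp add: forward_interval_def)
  have x_cont: "continuous_on {a..b} x"
    by (rule filippov_solution_continuous_on[OF x])
  define X where "X = x ` {a..b}"
  have "compact X" "open U" "X \<subseteq> U"
    using x_cont xU sys by (auto simp: X_def bimodal_system_def intro: compact_continuous_image)
  \<comment> \<open>The closed \<open>\<rho>\<close>-tube \<open>W\<close> around the trajectory is
    compact and lies in \<open>U\<close>; the extensions agree with the original data on it.\<close>
  then obtain \<rho> where "\<rho> > 0" and \<rho>: "(\<Union>p\<in>X. cball p \<rho>) \<subseteq> U"
    by (rule compact_subset_open_imp_cball_epsilon_subset)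
  define W where "W = (\<Union>p\<in>X. cball p \<rho>)"
  have "compact W"
    unfolding W_def by (rule compact_minkowski_sum_cball) fact
  have W: "p \<in> W" if "t \<in> {a..b}" "norm (p - x t) \<le> \<rho>" for p t
    using that by (auto simp: W_def X_def dist_norm norm_minus_commute)
  have "W \<subseteq> U"
    using \<rho> by (simp add: W_def)
  note cont = bimodal_system_continuous_on[OF sys, THEN continuous_on_subset, OF \<open>W \<subseteq> U\<close>]
  obtain gp Mp where gp: "continuous_on UNIV gp" "\<And>p. p \<in> W \<Longrightarrow> gp p = fp p" "\<And>p. norm (gp p) \<le> Mp"
    using bounded_continuous_extension[OF \<open>compact W\<close> cont(1)] by blast
  obtain gm Mm where gm: "continuous_on UNIV gm" "\<And>p. p \<in> W \<Longrightarrow> gm p = fm p" "\<And>p. norm (gm p) \<le> Mm"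
    using bounded_continuous_extension[OF \<open>compact W\<close> cont(2)] by blast
  obtain G MG where G: "continuous_on UNIV G" "\<And>p. p \<in> W \<Longrightarrow> G p = H p" "\<And>p. norm (G p) \<le> (MG :: real)"
    using bounded_continuous_extension[OF \<open>compact W\<close> cont(3)] by blast
  define M where "M = max Mp Mm"
  have gp_bound: "norm (gp p) \<le> M" and gm_bound: "norm (gm p) \<le> M" for p
    using gp(3)[of p] gm(3)[of p] by (auto simp: M_def)
  have \<phi>_cont: "continuous_on UNIV \<phi>"
    using \<phi> by (simp add: transition_function_def)
  have "\<exists>u. u a = x a \<and> (\<forall>t\<in>{a..b}. (u has_vector_derivative regularization \<phi> gp gm G (\<epsilon> k) (u t)) (at t within {a..b}))" for k
  proof -
    have "continuous_on UNIV (regularization \<phi> gp gm G (\<epsilon> k))"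
      unfolding regularization_def using eps_pos[of k]
      by (auto intro!: continuous_intros gp(1) gm(1) G(1) continuous_on_compose2[OF \<phi>_cont])
    moreover have "norm (regularization \<phi> gp gm G (\<epsilon> k) p) \<le> M + M" for p
    proof -
      let ?l = "\<phi> (G p / \<epsilon> k)"
      have l: "-1 \<le> ?l" "?l \<le> 1"
        by (rule transition_function_bounds[OF \<phi>])+
      have "norm ((1/2 * (1 + ?l)) *\<^sub>R gp p) \<le> 1 * M" "norm ((1/2 * (1 - ?l)) *\<^sub>R gm p) \<le> 1 * M"
        unfolding norm_scaleR using l gp_bound gm_bound by (intro mult_mono; simp)+
      then show ?thesis
        unfolding regularization_def by (intro norm_triangle_le) simp
    qed
    ultimately show ?thesis
      using Peano_existence[of "regularization \<phi> gp gm G (\<epsilon> k)" "M + M" a "x a" b] by metis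
  qed
  then obtain u where u_initial: "\<And>k. u k a = x a"
    and u: "\<And>k t. t \<in> {a..b} \<Longrightarrow> (u k has_vector_derivative regularization \<phi> gp gm G (\<epsilon> k) (u k t)) (at t within {a..b})"
    by metis
  obtain z r where "strict_mono (r :: nat \<Rightarrow> nat)"
    and z_conv: "\<And>e. e > 0 \<Longrightarrow> \<exists>n0. \<forall>n\<ge>n0. \<forall>t\<in>{a..b}. norm (u (r n) t - z t) < e"
    and z_lip: "\<And>s t. s \<in> {a..b} \<Longrightarrow> t \<in> {a..b} \<Longrightarrow> norm (z s - z t) \<le> (M + 1) * \<bar>s - t\<bar>"
    and z_ae: "AE t in lebesgue. t \<in> {a..b} \<longrightarrow>
       (\<exists>v\<in>filippov_field gp gm G (z t). (z has_vector_derivative v) (at t within {a..b}))"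
    by (rule regularization_solutions_limit[OF gp(1) gm(1) G(1) gp_bound gm_bound \<phi> eps_pos eps_lim \<open>a \<le> b\<close> u_initial u])
      (assumption, rule that)
  have z_cont: "continuous_on {a..b} z"
    using z_lip by (rule Lipschitz_imp_continuous_on)
  have "(\<lambda>n. u (r n) a) \<longlonglongrightarrow> z a"
    using z_conv \<open>a \<le> b\<close> unfolding LIMSEQ_iff by force
  then have z_initial: "z a = x a"
    by (simp add: u_initial LIMSEQ_const_iff)
  \<comment> \<open>While \<open>z\<close> stays in the tube, the extended and original Filippov
    fields coincide along it, so \<open>z\<close> solves the original inclusion and right uniqueness
    applies.\<close>
  have z_eq_x: "z T = x T" if T: "T \<in> {a..b}" and tube: "\<And>t. t \<in> {a..T} \<Longrightarrow> norm (z t - x t) \<le> \<rho>" for T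
  proof -
    have sub: "{a..T} \<subseteq> {a..b}"
      using T by auto
    have zW: "z t \<in> W" if "t \<in> {a..T}" for t
      using W[of t "z t"] tube[OF that] that sub by blast
    have "filippov_solution U fp fm H a {a..T} z"
      unfolding filippov_solution_def
    proof (intro conjI ballI allI impI)
      show "forward_interval a {a..T}"
        using T by (auto simp: forward_interval_def is_interval_cc)
      show "z t \<in> U" if "t \<in> {a..T}" for t
        using zW[OF that] \<open>W \<subseteq> U\<close> by blast
      show "absolutely_continuous_on {c..d} z" if "{c..d} \<subseteq> {a..T}" for c d
        using z_lip that sub by (intro Lipschitz_imp_absolutely_continuous_on[of _ z "M + 1"]) blast
      show "AE t in lebesgue. t \<in> {a..T} \<longrightarrow>
          (\<exists>v\<in>filippov_field fp fm H (z t). (z has_vector_derivative v) (at t within {a..T}))"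
        using z_ae
      proof eventually_elim
        case (elim t)
        show ?case
        proof
          assume t: "t \<in> {a..T}"
          then have "filippov_field gp gm G (z t) = filippov_field fp fm H (z t)"
            using zW by (simp add: filippov_field_def gp(2) gm(2) G(2))
          then show "\<exists>v\<in>filippov_field fp fm H (z t). (z has_vector_derivative v) (at t within {a..T})"
            using elim t sub has_vector_derivative_within_subset by (metis subsetD)
        qed
      qed
    qed
    moreover have "filippov_solution U fp fm H a {a..T} x"
      by (rule filippov_solution_subinterval[OF x T])
    ultimately show ?thesis
      using unique z_initial T unfolding right_unique_solutions_def by fastforce
  qed
  have z_near: "norm (z t - x t) < \<rho>" if "t \<in> {a..b}" for t
  proof (rule ccontr)
    \<comment> \<open>At the first exit time from the tube the two Filippov solutions would still agree.\<close>
    define A where "A = {t \<in> {a..b}. \<rho> \<le> norm (z t - x t)}"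
    assume "\<not> norm (z t - x t) < \<rho>"
    then have "A \<noteq> {}"
      using that by (auto simp: A_def)
    have norm_cont: "continuous_on {a..b} (\<lambda>t. norm (z t - x t))"
      by (intro continuous_intros z_cont x_cont)
    then have "closed A"
      unfolding A_def by (intro continuous_on_closed_Collect_le continuous_on_const) auto
    moreover have "bounded A"
      by (rule bounded_subset[OF bounded_closed_interval[of a b]]) (auto simp: A_def)
    ultimately have "compact A"
      by (simp add: compact_eq_bounded_closed)
    then obtain T where "T \<in> A" and first: "\<And>t. t \<in> A \<Longrightarrow> T \<le> t"
      using compact_attains_inf[OF _ \<open>A \<noteq> {}\<close>] by metis
    have T: "T \<in> {a..b}" "\<rho> \<le> norm (z T - x T)"
      using \<open>T \<in> A\<close> by (auto simp: A_def)
    \<comment> \<open>By the intermediate value theorem and minimality of \<open>T\<close>, the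
      distance at \<open>T\<close> is exactly \<open>\<rho>\<close>. So \<open>z\<close> lies in the
      closed tube up to and including \<open>T\<close>, and \<open>z_eq_x\<close> makes the distance
      0 there.\<close>
    have "\<exists>s\<ge>a. s \<le> T \<and> norm (z s - x s) = \<rho>"
      using T \<open>\<rho> > 0\<close> by (intro IVT' continuous_on_subset[OF norm_cont]) (auto simp: z_initial)
    then obtain s where s: "a \<le> s" "s \<le> T" "norm (z s - x s) = \<rho>"
      by blast
    then have "s \<in> A"
      using T by (auto simp: A_def)
    with first s have "s = T"
      by force
    have "norm (z t - x t) \<le> \<rho>" if "t \<in> {a..T}" for t
    proof (cases "t \<in> A")
      case True
      then show ?thesis
        using first[of t] that s \<open>s = T\<close> by simp
    next
      case False
      then show ?thesis
        using that T by (auto simp: A_def)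
    qed
    then show False
      using z_eq_x[OF T(1)] T(2) \<open>\<rho> > 0\<close> by simp
  qed
  then have z_eq: "z t = x t" if "t \<in> {a..b}" for t
    using z_eq_x[OF that] that by (meson atLeastAtMost_iff less_imp_le order_trans)
  \<comment> \<open>The bound \<open>\<rho>\<close> keeps \<open>u (r n)\<close> in
    \<open>W\<close>, where it solves the original regularized system; the bound \<open>e\<close>
    contradicts the choice of \<open>\<epsilon>\<close>.\<close>
  obtain n where n: "\<And>t. t \<in> {a..b} \<Longrightarrow> norm (u (r n) t - x t) < min \<rho> e"
    using z_conv[of "min \<rho> e"] \<open>\<rho> > 0\<close> \<open>e > 0\<close> z_eq by force
  have "u (r n) t \<in> W" if "t \<in> {a..b}" for t
    using W[OF that] n[OF that] by simp
  then have "classical_solution U (regularization \<phi> fp fm H (\<epsilon> (r n))) a {a..b} (u (r n))"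
    using interval u[of _ "r n"] \<open>W \<subseteq> U\<close>
    by (auto simp: classical_solution_def regularization_def gp(2) gm(2) G(2) subset_iff)
  then show False
    using no_approx[of "r n" "u (r n)"] n u_initial by auto
qed

section \<open>Passage to the limit in the contraction estimate\<close>

lemma is_norm_le_norm:
  fixes N :: "'a::euclidean_space \<Rightarrow> real"
  assumes "is_norm N"
  obtains B where "B > 0" "\<And>p. N p \<le> B * norm p"
proof
  \<comment> \<open>Expanding \<open>p\<close> in the orthonormal basis bounds \<open>N p\<close> by
    \<open>B * norm p\<close>. Adding 1 makes the constant positive.\<close>
  define B where "B = (\<Sum>b\<in>Basis. N b)"
  have nonneg: "N p \<ge> 0" and scale: "N (c *\<^sub>R p) = \<bar>c\<bar> * N p" and add: "N (p + q) \<le> N p + N q" for c p q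
    using assms by (auto simp: is_norm_def)
  have N_sum: "N (\<Sum>b\<in>S. h b) \<le> (\<Sum>b\<in>S. N (h b))" if "finite S" for S and h :: "'a \<Rightarrow> 'a"
    using that
  proof induction
    case empty
    then show ?case
      using scale[of 0 0] by simp
  next
    case (insert b S)
    then show ?case
      using add[of "h b" "sum h S"] by simp
  qed
  show "B + 1 > 0"
    using nonneg by (simp add: B_def sum_nonneg add_nonneg_pos)
  show "N p \<le> (B + 1) * norm p" for p
  proof -
    have "N p = N (\<Sum>b\<in>Basis. (p \<bullet> b) *\<^sub>R b)"
      by (simp add: euclidean_representation)
    also have "\<dots> \<le> (\<Sum>b\<in>Basis. N ((p \<bullet> b) *\<^sub>R b))"
      by (rule N_sum) simp
    also have "\<dots> \<le> (\<Sum>b\<in>Basis. norm p * N b)"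
      unfolding scale by (intro sum_mono mult_right_mono nonneg Basis_le_norm)
    also have "\<dots> = B * norm p"
      by (simp add: B_def sum_distrib_left mult.commute)
    also have "\<dots> \<le> (B + 1) * norm p"
      by (simp add: mult_right_mono)
    finally show ?thesis .
  qed
qed

theorem theorem5:
  fixes U C :: "(real^'n) set"
    and f_plus f_minus :: "real^'n \<Rightarrow> real^'n"
    and H :: "real^'n \<Rightarrow> real"
    and \<phi> :: "real \<Rightarrow> real"
    and N :: "real^'n \<Rightarrow> real"
    and K c \<epsilon>_bar t0 :: real
    and J :: "real set"
    and x y :: "real \<Rightarrow> real^'n"
  assumes "bimodal_system U f_plus f_minus H"
    and "right_unique_solutions (filippov_solution U f_plus f_minus H)"
    and "transition_function \<phi>"
    and "is_norm N"
    and "K > 0" and "c > 0"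
    and "C \<subseteq> U"
    and "K_reachable N K C"
    and "forward_invariant (filippov_solution U f_plus f_minus H) C"
    and "0 < \<epsilon>_bar" and "\<epsilon>_bar < 1"
    and "\<And>\<epsilon>. 0 < \<epsilon> \<Longrightarrow> \<epsilon> < \<epsilon>_bar \<Longrightarrow>
           incrementally_exponentially_stable N
             (classical_solution U (regularization \<phi> f_plus f_minus H \<epsilon>)) C K c"
    and "filippov_solution U f_plus f_minus H t0 J x" and "x t0 \<in> C"
    and "filippov_solution U f_plus f_minus H t0 J y" and "y t0 \<in> C"
  shows "\<forall>t\<in>J. x t \<in> C \<and> y t \<in> C \<and>
           N (x t - y t) \<le> K * exp (- c * (t - t0)) * N (x t0 - y t0)"
proof (intro ballI conjI)
  fix T assume T: "T \<in> J"
  show "x T \<in> C" "y T \<in> C"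
    using assms(9,13-16) T unfolding forward_invariant_def by blast+
  have "t0 \<le> T"
    using assms(13) T by (simp add: filippov_solution_def forward_interval_def)
  then have T_in: "T \<in> {t0..T}"
    by simp
  have x: "filippov_solution U f_plus f_minus H t0 {t0..T} x"
    and y: "filippov_solution U f_plus f_minus H t0 {t0..T} y"
    using assms(13,15) T by (auto intro: filippov_solution_subinterval)
  obtain B where "B > 0" and B: "\<And>p. N p \<le> B * norm p"
    using is_norm_le_norm[OF assms(4)] by blast
  show "N (x T - y T) \<le> K * exp (- c * (T - t0)) * N (x t0 - y t0)"
  proof (rule field_le_epsilon)
    fix e :: real assume "e > 0"
    \<comment> \<open>There are two approximation errors, one for each solution; measured in
      \<open>N\<close>, each is at most \<open>B * \<delta>\<close>, half of
      \<open>e\<close>.\<close>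
    define \<delta> where "\<delta> = e / (2 * B)"
    have "\<delta> > 0"
      using \<open>e > 0\<close> \<open>B > 0\<close> by (simp add: \<delta>_def)
    obtain \<epsilon>1 where 1: "\<epsilon>1 > 0" "\<And>\<epsilon>. 0 < \<epsilon> \<Longrightarrow> \<epsilon> < \<epsilon>1 \<Longrightarrow>
        \<exists>u. classical_solution U (regularization \<phi> f_plus f_minus H \<epsilon>) t0 {t0..T} u \<and> u t0 = x t0 \<and> (\<forall>t\<in>{t0..T}. norm (u t - x t) < \<delta>)"
      using regularization_approximates_filippov_solution[OF assms(1-3) x \<open>\<delta> > 0\<close>] by blast
    obtain \<epsilon>2 where 2: "\<epsilon>2 > 0" "\<And>\<epsilon>. 0 < \<epsilon> \<Longrightarrow> \<epsilon> < \<epsilon>2 \<Longrightarrow>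
        \<exists>u. classical_solution U (regularization \<phi> f_plus f_minus H \<epsilon>) t0 {t0..T} u \<and> u t0 = y t0 \<and> (\<forall>t\<in>{t0..T}. norm (u t - y t) < \<delta>)"
      using regularization_approximates_filippov_solution[OF assms(1-3) y \<open>\<delta> > 0\<close>] by blast
    define \<epsilon> where "\<epsilon> = min \<epsilon>_bar (min \<epsilon>1 \<epsilon>2) / 2"
    have \<epsilon>: "0 < \<epsilon>" "\<epsilon> < \<epsilon>_bar" "\<epsilon> < \<epsilon>1" "\<epsilon> < \<epsilon>2"
      using 1(1) 2(1) assms(10) by (auto simp: \<epsilon>_def)
    obtain u where u: "classical_solution U (regularization \<phi> f_plus f_minus H \<epsilon>) t0 {t0..T} u"
      "u t0 = x t0" "norm (u T - x T) < \<delta>"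
      using 1(2)[OF \<epsilon>(1,3)] T_in by blast
    obtain v where v: "classical_solution U (regularization \<phi> f_plus f_minus H \<epsilon>) t0 {t0..T} v"
      "v t0 = y t0" "norm (v T - y T) < \<delta>"
      using 2(2)[OF \<epsilon>(1,4)] T_in by blast
    \<comment> \<open>\<open>u\<close> and \<open>v\<close> solve the same regularized system and
      start exactly at \<open>x t0\<close> and \<open>y t0\<close>, so the right-hand side carries
      no approximation error.\<close>
    have "N (u T - v T) \<le> K * exp (- c * (T - t0)) * N (u t0 - v t0)"
      using assms(12)[OF \<epsilon>(1,2)] u(1,2) v(1,2) assms(14,16) T_in
      unfolding incrementally_exponentially_stable_def by metis
    moreover have "N (x T - y T) \<le> N (x T - u T) + N (u T - v T) + N (v T - y T)"
    proof -
      have add: "N (p + q) \<le> N p + N q" for p q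
        using assms(4) by (simp add: is_norm_def)
      show ?thesis
        using add[of "x T - u T" "u T - y T"] add[of "u T - v T" "v T - y T"] by simp
    qed
    moreover have "N (x T - u T) \<le> B * \<delta>" "N (v T - y T) \<le> B * \<delta>"
      using B[of "x T - u T"] B[of "v T - y T"] u(3) v(3) \<open>B > 0\<close>
      by (smt (verit, best) mult_left_mono norm_minus_commute)+
    moreover have "B * \<delta> + B * \<delta> = e"
      using \<open>B > 0\<close> by (simp add: \<delta>_def)
    ultimately show "N (x T - y T) \<le> K * exp (- c * (T - t0)) * N (x t0 - y t0) + e"
      using u(2) v(2) by simp
  qed
qed

end
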